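(* Let $A$ and $A'$ be matrices in $\mathbb{C}^{d\times d}$. Then the Horn matrix function $G_3(A,A';x,y)$ satisfies the following infinite summation formulae for $|t|<1$: (1) $(1-t)^{-A}\,G_3\!\left(A,A';x(1-t),\frac{y}{(1-t)^2}\right)=\sum_{n=0}^{\infty}\frac{(A)_n}{n!}\,G_3(A+nI,A';x,y)\,t^n$; (2) $G_3\!\left(A,A';\frac{x}{(1-t)^2},y(1-t)\right)(1-t)^{-A'}=\sum_{n=0}^{\infty}G_3(A,A'+nI;x,y)\,\frac{(A')_n}{n!}\,t^n$.
   Context: $G_3(A,A';x,y)=\sum_{m,n=0}^{\infty}(A)_{2n-m}(A')_{2m-n}\frac{x^m y^n}{m!\,n!}$. Matrix Pochhammer symbol: for $M\in\mathbb{C}^{d\times d}$, $(M)_0=I$, $(M)_n=M(M+I)\cdots(M+(n-1)I)$ for $n\ge1$, and $(M)_{-n}=(-1)^n(I-M)_n^{-1}$. For $|t|<1$, $(1-t)^{-M}=\sum_{n\ge0}\frac{(M)_n}{n!}t^n$.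
   Formalization: All Pochhammer symbols in the formula are assumed defined and both argument points of G_3 to lie in the interior of absolute convergence; equality is claimed when the right-hand series converges, which is proved if the left argument stays in that domain for all |s|≤|t|, as it can diverge for |t|<1. *)

theory Defs
  imports "HOL-Analysis.Analysis"
begin

text \<open>Only real scalars act on \<^typ>\<open>complex^'d^'d\<close> through \<open>*\<^sub>R\<close>, and \<open>*s\<close> does not
  apply to matrices, hence a complex scalar multiplication.\<close>

definition mscale :: "complex \<Rightarrow> complex^'d^'d \<Rightarrow> complex^'d^'d"  (infixr "*\<^sub>M" 75)
  where "c *\<^sub>M M = (\<chi> i j. c * M $ i $ j)"

primrec mpoch_nat :: "complex^'d^'d \<Rightarrow> nat \<Rightarrow> complex^'d^'d" where
  "mpoch_nat M 0 = mat 1"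
| "mpoch_nat M (Suc n) = mpoch_nat M n ** (M + mat (of_nat n))"

definition mpoch :: "complex^'d^'d \<Rightarrow> int \<Rightarrow> complex^'d^'d" where
  "mpoch M k = (if 0 \<le> k then mpoch_nat M (nat k)
     else (- 1) ^ nat (- k) *\<^sub>M matrix_inv (mpoch_nat (mat 1 - M) (nat (- k))))"

text \<open>All inverses occurring in \<^const>\<open>mpoch\<close> exist (\<^const>\<open>matrix_inv\<close> is unspecified on
  singular matrices).\<close>

definition mpoch_defined :: "complex^'d^'d \<Rightarrow> bool" where
  "mpoch_defined M \<longleftrightarrow> (\<forall>n. invertible (mpoch_nat (mat 1 - M) n))"

text \<open>The power \<open>(1 - t)\<^sup>-\<^sup>M\<close>, for \<open>norm t < 1\<close>.\<close>

definition one_minus_pow_neg :: "complex \<Rightarrow> complex^'d^'d \<Rightarrow> complex^'d^'d" where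
  "one_minus_pow_neg t M = (\<Sum>n. (t ^ n / fact n) *\<^sub>M mpoch M (int n))"

definition G3_term ::
  "complex^'d^'d \<Rightarrow> complex^'d^'d \<Rightarrow> complex \<Rightarrow> complex \<Rightarrow> nat \<Rightarrow> nat \<Rightarrow> complex^'d^'d" where
  "G3_term A A' x y m n = (x ^ m * y ^ n / (fact m * fact n)) *\<^sub>M
     (mpoch A (2 * int n - int m) ** mpoch A' (2 * int m - int n))"

definition G3 ::
  "complex^'d^'d \<Rightarrow> complex^'d^'d \<Rightarrow> complex \<Rightarrow> complex \<Rightarrow> complex^'d^'d" where
  "G3 A A' x y = (\<Sum>\<^sub>\<infinity>(m, n)\<in>UNIV. G3_term A A' x y m n)"

text \<open>As usual for a multiple power series, the domain of convergence is the interior of the set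
  of points of absolute convergence.\<close>

definition G3_domain :: "complex^'d^'d \<Rightarrow> complex^'d^'d \<Rightarrow> (complex \<times> complex) set" where
  "G3_domain A A' = interior
    {(x, y). (\<lambda>(m, n). norm (G3_term A A' x y m n)) summable_on UNIV}"

end

theory Submission
  imports Defs "HOL-Complex_Analysis.Complex_Analysis"
begin

text \<open>
  Write \<open>T\<^sub>m\<^sub>n\<close> for the terms of \<open>G\<^sub>3(A, A'; x, y)\<close> and \<open>j = 2 n - m\<close>. The formal reason for the first
  formula is the double reading \<open>(A)\<^sub>k (A + k)\<^sub>j = (A)\<^sub>j\<^sub>+\<^sub>k = (A + j)\<^sub>k (A)\<^sub>j\<close>
  (\<open>mpoch_nat_mult_mpoch_shift\<close>). It makes the right-hand side the triple sum of
  \<open>(t\<^sup>k / k!) (A + j)\<^sub>k T\<^sub>m\<^sub>n\<close>, and the sum over \<open>k\<close> is \<open>(1 - t)\<^sup>-\<^sup>A (1 - t)\<^sup>m\<^sup>-\<^sup>2\<^sup>n T\<^sub>m\<^sub>n\<close>, a term of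
  the left-hand side.

  The triple sum need not converge absolutely at the given \<open>t\<close>, but it does for parameters \<open>s\<close> close
  to 0 (\<open>G3_expansion_at_0\<close>), so the formula holds there, and the right-hand side is the Taylor series
  of the left-hand side. As a function of \<open>c = 1 - s\<close>, the series \<open>G\<^sub>3(x c, y / c\<^sup>2)\<close> is a Laurent
  series. Its annulus of convergence contains the radius 1, because \<open>(x, y)\<close> lies in the domain, and
  the radius \<open>cmod (1 - t)\<close>, because the scaled point does; and it contains all radii in between. The
  left-hand side is thus holomorphic where this annulus, with centre \<open>s = 1\<close>, meets the unit disc.

  If the right-hand side converges at \<open>t\<close>, the identity theorem on the intersection of the annulus with
  the disc \<open>cmod s < cmod t\<close> gives equality arbitrarily near \<open>t\<close>, and Abel's limit theorem gives it at
  \<open>t\<close> (\<open>power_series_sums_by_continuation\<close>). If all \<open>s\<close> with \<open>cmod s \<le> cmod t\<close> are admissible, the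
  annulus contains a larger disc about \<open>s = 0\<close>, and the Taylor series converges at \<open>t\<close>
  (\<open>power_series_summable_by_continuation\<close>).

  The second formula is the transpose of the first: transposition reverses products, so it exchanges
  \<open>(A, x)\<close> with \<open>(A', y)\<close> and moves the power from the left to the right.\<close>

section \<open>Matrices over the complex numbers\<close>

lemma mscale_nth [simp]: "(c *\<^sub>M M) $ i $ j = c * M $ i $ j"
  by (simp add: mscale_def)

lemma mscale_one [simp]: "1 *\<^sub>M M = M"
  by (simp add: vec_eq_iff)

lemma mscale_zero [simp]: "0 *\<^sub>M M = 0"
  by (simp add: vec_eq_iff)

lemma mscale_mscale [simp]: "a *\<^sub>M b *\<^sub>M M = (a * b) *\<^sub>M M"
  by (simp add: vec_eq_iff)

lemma mscale_mult_left [simp]: "(c *\<^sub>M X) ** Y = c *\<^sub>M (X ** Y)"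
  by (simp add: vec_eq_iff matrix_matrix_mult_def sum_distrib_left mult.assoc)

lemma mscale_mult_right [simp]: "X ** (c *\<^sub>M Y) = c *\<^sub>M (X ** Y)"
  by (simp add: vec_eq_iff matrix_matrix_mult_def sum_distrib_left mult.left_commute)

lemma mat_mult_eq_mscale: "mat c ** X = c *\<^sub>M X"
  by (simp add: vec_eq_iff matrix_matrix_mult_def mat_def if_distrib if_distribR sum.delta
      cong: if_cong)

lemma mult_mat_eq_mscale: "X ** mat c = c *\<^sub>M X"
  by (simp add: vec_eq_iff matrix_matrix_mult_def mat_def if_distrib if_distribR sum.delta
      mult.commute cong: if_cong)

lemma mscale_mat [simp]: "a *\<^sub>M mat b = mat (a * b)"
  by (simp add: vec_eq_iff mat_def)

lemma mscale_add_right: "c *\<^sub>M (X + Y) = c *\<^sub>M X + c *\<^sub>M Y"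
  by (simp add: vec_eq_iff algebra_simps)

lemma matrix_add_rdistrib: "(X + Y) ** Z = X ** Z + Y ** (Z :: 'a::semiring_1^'p^'n)"
  by (simp add: vec_eq_iff matrix_matrix_mult_def distrib_right sum.distrib)

lemma transpose_mscale: "transpose (c *\<^sub>M M) = c *\<^sub>M transpose M"
  by (simp add: vec_eq_iff transpose_def)

lemma mat_add: "mat a + mat b = (mat (a + b) :: 'a::comm_monoid_add^'n^'n)"
  by (simp add: vec_eq_iff mat_def)

lemma norm_mscale: "norm (c *\<^sub>M M) = norm c * norm M"
proof -
  have row: "norm ((c *\<^sub>M M) $ i) = norm c * norm (M $ i)" for i
    unfolding norm_vec_def by (simp add: norm_mult L2_set_right_distrib)
  show ?thesis
    unfolding norm_vec_def[of "c *\<^sub>M M"] row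
    by (simp add: L2_set_right_distrib norm_vec_def[of M])
qed

lemma bounded_linear_mscale: "bounded_linear (\<lambda>X. c *\<^sub>M X)"
  by (intro linear_conv_bounded_linear[THEN iffD1] linearI)
     (simp_all add: vec_eq_iff algebra_simps)

lemma bounded_bilinear_matrix_mult:
  "bounded_bilinear (\<lambda>(X :: complex^'n^'m) (Y :: complex^'p^'n). X ** Y)"
proof -
  have "linear (\<lambda>Z :: complex^'p^'n. X ** Z)" "linear (\<lambda>Z :: complex^'n^'m. Z ** Y)"
    for X :: "complex^'n^'m" and Y :: "complex^'p^'n"
    by (intro linearI; simp add: vec_eq_iff matrix_matrix_mult_def distrib_left distrib_right
        sum.distrib scaleR_sum_right)+
  then show ?thesis
    by (simp add: bilinear_def flip: bilinear_conv_bounded_bilinear)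
qed

lemma norm_transpose: "norm (transpose M) = norm (M :: complex^'n^'m)"
proof -
  have "(\<Sum>i\<in>UNIV. \<Sum>j\<in>UNIV. (cmod (transpose M $ i $ j))\<^sup>2)
      = (\<Sum>i\<in>UNIV. \<Sum>j\<in>UNIV. (cmod (M $ i $ j))\<^sup>2)"
    unfolding transpose_def by (subst sum.swap) simp
  then show ?thesis
    by (simp add: norm_vec_def L2_set_def sum_nonneg)
qed

text \<open>
  The norm of a matrix is the Frobenius norm, so Cauchy--Schwarz on the entries of the product makes
  it submultiplicative.\<close>

lemma norm_matrix_mult_le:
  "norm (X ** Y) \<le> norm X * norm (Y :: complex^'p^'n)" for X :: "complex^'n^'m"
proof -
  have entry: "cmod ((X ** Y) $ i $ j) \<le> norm (X $ i) * norm (transpose Y $ j)" for i j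
  proof -
    have "cmod ((X ** Y) $ i $ j) \<le> (\<Sum>k\<in>UNIV. \<bar>cmod (X $ i $ k)\<bar> * \<bar>cmod (Y $ k $ j)\<bar>)"
      unfolding matrix_matrix_mult_def by (simp add: sum_norm_le norm_mult)
    also have "\<dots> \<le> L2_set (\<lambda>k. cmod (X $ i $ k)) UNIV * L2_set (\<lambda>k. cmod (Y $ k $ j)) UNIV"
      by (rule L2_set_mult_ineq)
    finally show ?thesis
      by (simp add: norm_vec_def transpose_def)
  qed
  have row: "norm ((X ** Y) $ i) \<le> norm (X $ i) * norm (transpose Y)" for i
  proof -
    have "norm ((X ** Y) $ i) \<le> L2_set (\<lambda>j. norm (X $ i) * norm (transpose Y $ j)) UNIV"
      unfolding norm_vec_def[of "(X ** Y) $ i"] by (rule L2_set_mono) (rule entry, rule norm_ge_zero)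
    then show ?thesis
      by (simp add: norm_vec_def[of "transpose Y"] flip: L2_set_right_distrib)
  qed
  have "norm (X ** Y) \<le> L2_set (\<lambda>i. norm (X $ i) * norm (transpose Y)) UNIV"
    unfolding norm_vec_def[of "X ** Y"] by (rule L2_set_mono) (rule row, rule norm_ge_zero)
  also have "\<dots> = norm X * norm Y"
    by (simp add: L2_set_left_distrib norm_vec_def[of X] norm_transpose)
  finally show ?thesis .
qed

lemma invertible_matrix_inv:
  fixes X :: "'a::comm_ring_1^'n^'n"
  assumes "invertible X"
  shows "X ** matrix_inv X = mat 1" "matrix_inv X ** X = mat 1"
  using someI_ex[OF assms[unfolded invertible_def]] unfolding matrix_inv_def by blast+

lemma matrix_inv_eqI:
  fixes X :: "'a::comm_ring_1^'n^'n"
  assumes XY: "X ** Y = mat 1" and YX: "Y ** X = mat 1"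
  shows "matrix_inv X = Y"
proof -
  have "invertible X"
    using XY YX unfolding invertible_def by blast
  then have "matrix_inv X ** (X ** Y) = Y"
    by (simp add: matrix_mul_assoc invertible_matrix_inv)
  then show ?thesis
    by (simp add: XY)
qed

section \<open>The matrix Pochhammer symbol\<close>

lemma mpoch_of_nat [simp]: "mpoch M (int n) = mpoch_nat M n"
  by (simp add: mpoch_def)

lemma mpoch_nat_commute:
  assumes "X ** M = M ** X"
  shows "X ** mpoch_nat M n = mpoch_nat M n ** X"
proof (induction n)
  case (Suc n)
  have "X ** mpoch_nat M (Suc n) = mpoch_nat M n ** (X ** (M + mat (of_nat n)))"
    by (simp add: matrix_mul_assoc Suc)
  also have "X ** (M + mat (of_nat n)) = (M + mat (of_nat n)) ** X"
    by (simp add: matrix_add_ldistrib matrix_add_rdistrib assms mat_mult_eq_mscale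
        mult_mat_eq_mscale)
  finally show ?case
    by (simp only: mpoch_nat.simps matrix_mul_assoc)
qed simp

text \<open>
  Both factors are polynomials in \<open>M\<close>. This is what lets shifted Pochhammer symbols be rearranged
  as freely as scalar ones.\<close>

lemma mpoch_nat_shift_commute:
  "mpoch_nat (M + mat a) p ** mpoch_nat (M + mat b) q
     = mpoch_nat (M + mat b) q ** mpoch_nat (M + mat a) p"
proof (intro mpoch_nat_commute)
  have "(M + mat b) ** mpoch_nat (M + mat a) p = mpoch_nat (M + mat a) p ** (M + mat b)"
    by (intro mpoch_nat_commute)
       (simp add: matrix_add_ldistrib matrix_add_rdistrib mat_mult_eq_mscale
        mult_mat_eq_mscale mscale_add_right mult.commute)
  then show "mpoch_nat (M + mat a) p ** (M + mat b) = (M + mat b) ** mpoch_nat (M + mat a) p"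
    by simp
qed

lemma mpoch_nat_add:
  "mpoch_nat M (p + q) = mpoch_nat M p ** mpoch_nat (M + mat (of_nat p)) q"
  by (induction q) (simp_all add: matrix_mul_assoc add.assoc mat_add)

lemma mpoch_nat_add':
  assumes "c = b + of_nat p"
  shows "mpoch_nat (M + mat b) (p + q) = mpoch_nat (M + mat b) p ** mpoch_nat (M + mat c) q"
  using assms by (simp add: mpoch_nat_add add.assoc mat_add)

lemma mpoch_nat_reflect:
  "mpoch_nat (mat 1 - M) n = (- 1) ^ n *\<^sub>M mpoch_nat (M + mat (- of_nat n)) n"
proof (induction n)
  case (Suc n)
  let ?Z = "M + mat (- of_nat (Suc n))"
  have "mpoch_nat ?Z (1 + n) = mpoch_nat ?Z 1 ** mpoch_nat (M + mat (- of_nat n)) n"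
    by (rule mpoch_nat_add') simp
  also have "\<dots> = mpoch_nat (M + mat (- of_nat n)) n ** mpoch_nat ?Z 1"
    by (rule mpoch_nat_shift_commute)
  finally have Z: "mpoch_nat ?Z (Suc n) = mpoch_nat (M + mat (- of_nat n)) n ** ?Z"
    by (simp del: of_nat_Suc)
  have "mat 1 - M + mat (of_nat n) = (- 1) *\<^sub>M ?Z"
    by (simp add: vec_eq_iff mat_def)
  then have "mpoch_nat (mat 1 - M) (Suc n)
      = ((- 1) ^ n *\<^sub>M mpoch_nat (M + mat (- of_nat n)) n) ** ((- 1) *\<^sub>M ?Z)"
    by (simp only: mpoch_nat.simps(2) Suc)
  also have "\<dots> = (- 1) ^ Suc n *\<^sub>M mpoch_nat ?Z (Suc n)"
    by (simp only: Z mscale_mult_left mscale_mult_right mscale_mscale power_Suc mult.commute[of "- 1"])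
  finally show ?case .
qed simp

text \<open>
  The reflection above shows that \<open>(M)\<^sub>-\<^sub>n\<close> is the inverse of
  \<open>(M - n)\<^sub>n = (M - n) \<dots> (M - 1)\<close>. In this form no signs remain, and symbols of negative index
  combine with those of positive index by cancelling common factors.\<close>

lemma mpoch_neg:
  assumes "mpoch_defined M"
  shows "mpoch_nat (M + mat (- of_nat n)) n ** mpoch M (- int n) = mat 1"
    and "mpoch M (- int n) ** mpoch_nat (M + mat (- of_nat n)) n = mat 1"
proof -
  let ?P = "mpoch_nat (M + mat (- of_nat n)) n"
  let ?Q = "mpoch_nat (mat 1 - M) n"
  have sq: "(- 1 :: complex) ^ n * (- 1) ^ n = 1"
    by (simp flip: power_mult_distrib)
  have P: "?P = (- 1) ^ n *\<^sub>M ?Q"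
    by (simp add: mpoch_nat_reflect sq)
  have Q: "?Q ** matrix_inv ?Q = mat 1" "matrix_inv ?Q ** ?Q = mat 1"
    using assms unfolding mpoch_defined_def by (auto intro: invertible_matrix_inv)
  have *: "matrix_inv (mat 1) = (mat 1 :: complex^'a^'a)"
    by (rule matrix_inv_eqI) simp_all
  have "mpoch M (- int n) = (- 1) ^ n *\<^sub>M matrix_inv ?Q"
    by (cases "n = 0") (simp_all add: mpoch_def *)
  then show "?P ** mpoch M (- int n) = mat 1" "mpoch M (- int n) ** ?P = mat 1"
    unfolding P by (simp_all only: mscale_mult_left mscale_mult_right mscale_mscale Q sq mscale_one)
qed

lemma mpoch_neg_eqI:
  assumes "mpoch_defined M" and "mpoch_nat (M + mat (- of_nat n)) n ** Y = mat 1"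
  shows "mpoch M (- int n) = Y"
proof -
  let ?P = "mpoch_nat (M + mat (- of_nat n)) n"
  have "mpoch M (- int n) = mpoch M (- int n) ** (?P ** Y)"
    by (simp add: assms(2))
  also have "\<dots> = Y"
    by (simp add: matrix_mul_assoc mpoch_neg(2)[OF assms(1)])
  finally show ?thesis .
qed

text \<open>
  Definedness of all negative Pochhammer symbols of \<open>A + k\<close> excludes the eigenvalues
  \<open>1 - k, 2 - k, \<dots>\<close> of \<open>A\<close>, and \<open>(A)\<^sub>k\<close> is singular only if \<open>A\<close> has one of the eigenvalues
  \<open>0, -1, \<dots>, 1 - k\<close>.\<close>

lemma invertible_mpoch_nat:
  assumes "mpoch_defined (A + mat (of_nat k))"
  shows "invertible (mpoch_nat A k)"
proof -
  have *: "A + mat (of_nat k) + mat (- of_nat k) = A"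
    by (simp add: add.assoc mat_add)
  show ?thesis
    using mpoch_neg[OF assms, of k] unfolding invertible_def * by blast
qed

text \<open>
  Both sides are \<open>(A)\<^sub>j\<^sub>+\<^sub>k\<close>, split after \<open>k\<close> factors on the left and after \<open>j\<close> factors on the right.
  The identity turns the parameter shift \<open>A + k\<close> of the series into a factor \<open>(A + j)\<^sub>k\<close> in front
  of each term, which up to \<open>k!\<close> is a coefficient of the power of \<open>1 - s\<close> with exponent
  \<open>- (A + j)\<close>.\<close>

lemma mpoch_nat_mult_mpoch_shift:
  assumes A: "mpoch_defined A" and Ak: "mpoch_defined (A + mat (of_nat k))"
  shows "mpoch_nat A k ** mpoch (A + mat (of_nat k)) j = mpoch_nat (A + mat (of_int j)) k ** mpoch A j"
proof (cases "0 \<le> j")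
  case True
  then obtain p where j: "j = int p"
    using nonneg_int_cases by blast
  have "mpoch_nat A k ** mpoch_nat (A + mat (of_nat k)) p = mpoch_nat A (p + k)"
    by (simp only: mpoch_nat_add[symmetric] add.commute)
  also have "\<dots> = mpoch_nat (A + mat 0) p ** mpoch_nat (A + mat (of_nat p)) k"
    by (simp only: mpoch_nat_add mat_0 add_0_right)
  also have "\<dots> = mpoch_nat (A + mat (of_nat p)) k ** mpoch_nat (A + mat 0) p"
    by (rule mpoch_nat_shift_commute)
  finally show ?thesis
    by (simp only: j mat_0 mpoch_of_nat of_int_of_nat_eq add_0_right)
next
  case False
  then obtain p where j: "j = - int p"
    by (metis nonpos_int_cases linear)
  let ?B = "mpoch_nat (A + mat (- of_nat p))"
  let ?D = "mpoch_nat (A + mat (of_nat k - of_nat p)) p"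
  have D: "?D ** mpoch (A + mat (of_nat k)) (- int p) = mat 1"
    using mpoch_neg(1)[OF Ak, of p] by (simp add: add.assoc mat_add)
  have "?B p ** mpoch_nat (A + mat 0) k = ?B (k + p)"
    by (subst add.commute, subst mpoch_nat_add'[where c = 0]) simp_all
  also have "\<dots> = ?B k ** ?D"
    by (rule mpoch_nat_add') simp
  finally have "?B p ** mpoch_nat A k = ?B k ** ?D"
    by simp
  then have "mpoch_nat A k = mpoch A (- int p) ** (?B k ** ?D)"
    by (simp add: matrix_mul_assoc mpoch_neg(2)[OF A] flip: \<open>?B p ** mpoch_nat A k = ?B k ** ?D\<close>)
  then have "mpoch_nat A k ** mpoch (A + mat (of_nat k)) (- int p) = mpoch A (- int p) ** ?B k"
    by (simp add: D flip: matrix_mul_assoc)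
  also have "\<dots> = mpoch A (- int p) ** ?B k ** (?B p ** mpoch A (- int p))"
    by (simp add: mpoch_neg(1)[OF A])
  also have "\<dots> = mpoch A (- int p) ** (?B k ** ?B p) ** mpoch A (- int p)"
    by (simp add: matrix_mul_assoc)
  also have "?B k ** ?B p = ?B p ** ?B k"
    by (rule mpoch_nat_shift_commute)
  also have "mpoch A (- int p) ** (?B p ** ?B k) ** mpoch A (- int p) = ?B k ** mpoch A (- int p)"
    by (simp add: matrix_mul_assoc mpoch_neg(2)[OF A])
  finally show ?thesis
    by (simp only: j of_int_minus of_int_of_nat_eq)
qed

text \<open>
  Each new factor multiplies the norm by at most \<open>norm M + cmod c + n\<close>: the scalar part of the factor
  is estimated as a scalar, so that the norm of the identity matrix enters only once and the bound is
  sharp enough for convergence of the binomial series on the whole unit disc.\<close>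

lemma norm_mpoch_nat_le:
  "norm (mpoch_nat (M + mat c) n) \<le> norm (mat 1 :: complex^'d^'d) * pochhammer (norm M + cmod c) n"
  for M :: "complex^'d^'d"
proof (induction n)
  case (Suc n)
  let ?P = "mpoch_nat (M + mat c) n"
  have "mpoch_nat (M + mat c) (Suc n) = ?P ** M + (c + of_nat n) *\<^sub>M ?P"
    by (simp add: add.assoc mat_add matrix_add_ldistrib mult_mat_eq_mscale)
  also have "norm \<dots> \<le> norm ?P * norm M + cmod (c + of_nat n) * norm ?P"
    by (intro order_trans[OF norm_triangle_ineq] add_mono norm_matrix_mult_le) (simp add: norm_mscale)
  also have "\<dots> \<le> norm ?P * norm M + (cmod c + real n) * norm ?P"
    by (intro add_left_mono mult_right_mono order_trans[OF norm_triangle_ineq]) auto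
  also have "\<dots> = norm ?P * (norm M + cmod c + real n)"
    by (simp add: algebra_simps)
  also have "\<dots> \<le> norm (mat 1 :: complex^'d^'d) * pochhammer (norm M + cmod c) n * (norm M + cmod c + real n)"
    by (intro mult_right_mono Suc) auto
  finally show ?case
    by (simp add: pochhammer_Suc mult.assoc)
qed simp

section \<open>The power \<open>(1 - s)\<^sup>-\<^sup>M\<close>\<close>

lemma sums_pochhammer_powr:
  fixes a r :: real
  assumes "\<bar>r\<bar> < 1"
  shows "(\<lambda>k. pochhammer a k / fact k * r ^ k) sums (1 - r) powr (- a)"
proof -
  have "(\<lambda>k. (- a gchoose k) * (- r) ^ k) sums (1 + - r) powr (- a)"
    by (rule gen_binomial_real) (use assms in simp)
  moreover have "(- a gchoose k) * (- r) ^ k = pochhammer a k / fact k * r ^ k" for k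
  proof -
    have "(- 1 :: real) ^ k * (- r) ^ k = r ^ k"
      by (simp flip: power_mult_distrib)
    then show ?thesis
      by (simp add: gbinomial_pochhammer mult.commute mult.left_commute)
  qed
  ultimately show ?thesis
    by simp
qed

lemma norm_power_series_term_le:
  "norm ((s ^ k / fact k) *\<^sub>M mpoch_nat (M + mat c) k)
     \<le> norm (mat 1 :: complex^'d^'d) * (pochhammer (norm M + cmod c) k / fact k * cmod s ^ k)"
  for M :: "complex^'d^'d"
proof -
  have "norm ((s ^ k / fact k) *\<^sub>M mpoch_nat (M + mat c) k)
      = cmod s ^ k / fact k * norm (mpoch_nat (M + mat c) k)"
    by (simp add: norm_mscale norm_divide norm_power)
  also have "\<dots> \<le> cmod s ^ k / fact k * (norm (mat 1 :: complex^'d^'d) * pochhammer (norm M + cmod c) k)"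
    by (intro mult_left_mono norm_mpoch_nat_le) simp
  finally show ?thesis
    by (simp add: mult_ac)
qed

lemma one_minus_pow_neg_sums:
  fixes M :: "complex^'d^'d"
  assumes "norm s < 1"
  shows "summable (\<lambda>n. norm ((s ^ n / fact n) *\<^sub>M mpoch_nat M n))"
    and "(\<lambda>n. (s ^ n / fact n) *\<^sub>M mpoch_nat M n) sums one_minus_pow_neg s M"
proof -
  show *: "summable (\<lambda>n. norm ((s ^ n / fact n) *\<^sub>M mpoch_nat M n))"
  proof (rule summable_comparison_test')
    show "summable (\<lambda>k. norm (mat 1 :: complex^'d^'d) * (pochhammer (norm M) k / fact k * cmod s ^ k))"
      using sums_pochhammer_powr[of "cmod s" "norm M"] assms
      by (intro summable_mult) (auto simp: sums_iff)
    show "norm (norm ((s ^ k / fact k) *\<^sub>M mpoch_nat M k))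
       \<le> norm (mat 1 :: complex^'d^'d) * (pochhammer (norm M) k / fact k * cmod s ^ k)" for k
      using norm_power_series_term_le[of s k M 0] by simp
  qed
  show "(\<lambda>n. (s ^ n / fact n) *\<^sub>M mpoch_nat M n) sums one_minus_pow_neg s M"
    using summable_norm_cancel[OF *] by (simp add: one_minus_pow_neg_def summable_sums)
qed

text \<open>
  On coefficients this is \<open>(M + 1)\<^sub>n\<^sub>+\<^sub>1 - (n + 1) (M + 1)\<^sub>n = (M)\<^sub>n\<^sub>+\<^sub>1\<close>.\<close>

lemma one_minus_pow_neg_plus_one:
  assumes s: "norm s < 1"
  shows "(1 - s) *\<^sub>M one_minus_pow_neg s (M + mat 1) = one_minus_pow_neg s M"
proof -
  let ?P = "mpoch_nat (M + mat 1)"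
  define f where "f = (\<lambda>n. (s ^ n / fact n) *\<^sub>M ?P n)"
  define g where "g = (\<lambda>n. (s ^ n / fact n) *\<^sub>M mpoch_nat M n)"
  have f: "f sums one_minus_pow_neg s (M + mat 1)" and g: "g sums one_minus_pow_neg s M"
    unfolding f_def g_def by (intro one_minus_pow_neg_sums s)+
  have step: "f (Suc n) - s *\<^sub>M f n = g (Suc n)" for n
  proof -
    have "mpoch_nat M (Suc n) = M ** ?P n"
      using mpoch_nat_add[of M 1 n] by simp
    also have "\<dots> = ?P n ** M"
      by (intro mpoch_nat_commute)
         (simp add: matrix_add_ldistrib matrix_add_rdistrib mat_mult_eq_mscale mult_mat_eq_mscale)
    also have "\<dots> = ?P (Suc n) + (- of_nat (Suc n)) *\<^sub>M ?P n"
      by (simp add: add.assoc mat_add matrix_add_ldistrib mult_mat_eq_mscale vec_eq_iff algebra_simps)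
    finally have "mpoch_nat M (Suc n) = ?P (Suc n) + (- of_nat (Suc n)) *\<^sub>M ?P n" .
    moreover have "(s ^ Suc n / fact (Suc n)) *\<^sub>M (X + (- of_nat (Suc n)) *\<^sub>M Y)
        = (s ^ Suc n / fact (Suc n)) *\<^sub>M X - s *\<^sub>M (s ^ n / fact n) *\<^sub>M Y" for X Y
      by (simp add: vec_eq_iff divide_simps del: of_nat_Suc) (simp add: algebra_simps)
    ultimately show ?thesis
      unfolding f_def g_def by metis
  qed
  have "(\<lambda>n. f (Suc n)) sums (one_minus_pow_neg s (M + mat 1) - f 0)"
    using f by (simp add: sums_Suc_iff)
  moreover have "(\<lambda>n. s *\<^sub>M f n) sums (s *\<^sub>M one_minus_pow_neg s (M + mat 1))"
    by (rule bounded_linear.sums[OF bounded_linear_mscale f])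
  ultimately have "(\<lambda>n. g (Suc n)) sums
      (one_minus_pow_neg s (M + mat 1) - f 0 - s *\<^sub>M one_minus_pow_neg s (M + mat 1))"
    unfolding step[symmetric] by (rule sums_diff)
  moreover have "(\<lambda>n. g (Suc n)) sums (one_minus_pow_neg s M - g 0)"
    using g by (simp add: sums_Suc_iff)
  moreover have "f 0 = g 0"
    by (simp add: f_def g_def)
  ultimately have "one_minus_pow_neg s (M + mat 1) - s *\<^sub>M one_minus_pow_neg s (M + mat 1)
      = one_minus_pow_neg s M"
    using sums_unique2 by fastforce
  then show ?thesis
    by (simp add: vec_eq_iff algebra_simps)
qed

lemma one_minus_pow_neg_plus_int:
  assumes s: "norm s < 1"
  shows "one_minus_pow_neg s (M + mat (of_int j)) = (1 - s) powi (- j) *\<^sub>M one_minus_pow_neg s M"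
proof -
  have nz: "1 - s \<noteq> 0"
    using s by auto
  have up: "one_minus_pow_neg s (M + mat (c + 1)) = inverse (1 - s) *\<^sub>M one_minus_pow_neg s (M + mat c)" for c
    using one_minus_pow_neg_plus_one[OF s, of "M + mat c"] nz
    by (simp add: add.assoc mat_add flip: one_minus_pow_neg_plus_one[OF s, of "M + mat c"])
  show ?thesis
  proof (induction j rule: int_induct[where k = 0])
    case base
    show ?case by simp
  next
    case (step1 i)
    have "(1 - s) powi (- (i + 1)) = (1 - s) powi (- i) * inverse (1 - s)"
      using power_int_add[of "1 - s" "- i" "- 1"] nz by (simp add: power_int_minus)
    then show ?case
      using step1 up[of "of_int i"] by (simp add: mult.commute)
  next
    case (step2 i)
    have "(1 - s) powi (- (i - 1)) = (1 - s) * (1 - s) powi (- i)"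
      using power_int_add[of "1 - s" "1" "- i"] nz by (simp add: algebra_simps)
    moreover have "one_minus_pow_neg s (M + mat (of_int (i - 1)))
        = (1 - s) *\<^sub>M one_minus_pow_neg s (M + mat (of_int i))"
      using up[of "of_int i - 1"] nz by simp
    ultimately show ?case
      using step2 by simp
  qed
qed

section \<open>Scaling the arguments of the series\<close>

lemma G3_term_scale:
  assumes "c \<noteq> 0"
  shows "G3_term A A' (x * c) (y / c\<^sup>2) m n = c powi (int m - 2 * int n) *\<^sub>M G3_term A A' x y m n"
proof -
  have "c powi (int m - 2 * int n) = c ^ m / (c\<^sup>2) ^ n"
    using assms by (simp add: power_int_diff power_int_mult flip: power_mult)
  then show ?thesis
    by (simp add: G3_term_def power_mult_distrib power_divide mult_ac)
qed

text \<open>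
  The term of index \<open>(m, n)\<close> of \<open>G\<^sub>3(x c, y / c\<^sup>2)\<close> is the term of \<open>G\<^sub>3(x, y)\<close> times
  \<open>c\<^sup>m\<^sup>-\<^sup>2\<^sup>n\<close>. As a function of \<open>c\<close> the series is therefore a Laurent series, and the set below
  consists of the radii at which it converges absolutely.\<close>

definition scaling_radii :: "complex^'d^'d \<Rightarrow> complex^'d^'d \<Rightarrow> complex \<Rightarrow> complex \<Rightarrow> real set" where
  "scaling_radii A A' x y = {r. 0 < r \<and>
     (\<lambda>(m, n). r powi (int m - 2 * int n) * norm (G3_term A A' x y m n)) summable_on UNIV}"

lemma power_int_le_add_endpoints:
  fixes p q r :: real
  assumes "0 < p" "p \<le> r" "r \<le> q"
  shows "r powi e \<le> p powi e + q powi e"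
proof (cases "e \<ge> 0")
  case True
  then have "r powi e \<le> q powi e"
    using assms by (intro power_int_mono) auto
  moreover have "0 \<le> p powi e"
    using assms by simp
  ultimately show ?thesis by linarith
next
  case False
  then have "r powi e \<le> p powi e"
    using assms by (intro power_int_antimono) auto
  moreover have "0 \<le> q powi e"
    using assms by simp
  ultimately show ?thesis by linarith
qed

text \<open>
  A power \<open>r\<^sup>e\<close> is monotone or antimonotone in \<open>r\<close> according to the sign of \<open>e\<close>, so it is dominated
  by the sum of its values at the two ends of an interval. This is the convexity of the logarithmic
  image of a domain of convergence along the direction \<open>(1, - 2)\<close>.\<close>

lemma is_interval_scaling_radii: "is_interval (scaling_radii A A' x y)"
  unfolding is_interval_1
proof (intro ballI allI impI)
  fix p q r
  assume p: "p \<in> scaling_radii A A' x y" and q: "q \<in> scaling_radii A A' x y"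
    and r: "p \<le> r \<and> r \<le> q"
  let ?T = "\<lambda>(m, n). norm (G3_term A A' x y m n)"
  let ?e = "\<lambda>(m, n). int m - 2 * int n"
  have sm: "(\<lambda>i. p powi ?e i * ?T i + q powi ?e i * ?T i) summable_on UNIV"
    using p q by (intro summable_on_add) (auto simp: scaling_radii_def case_prod_unfold)
  have "(\<lambda>i. r powi ?e i * ?T i) summable_on UNIV"
  proof (rule summable_on_comparison_test[OF sm])
    fix i :: "nat \<times> nat"
    have "r powi ?e i \<le> p powi ?e i + q powi ?e i"
      using p r by (intro power_int_le_add_endpoints) (auto simp: scaling_radii_def)
    then have "r powi ?e i * ?T i \<le> (p powi ?e i + q powi ?e i) * ?T i"
      by (intro mult_right_mono) (auto simp: case_prod_unfold)
    then show "r powi ?e i * ?T i \<le> p powi ?e i * ?T i + q powi ?e i * ?T i"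
      by (simp add: algebra_simps)
    show "0 \<le> r powi ?e i * ?T i"
      using p r by (auto simp: scaling_radii_def case_prod_unfold)
  qed
  then show "r \<in> scaling_radii A A' x y"
    using p r by (auto simp: scaling_radii_def case_prod_unfold)
qed

text \<open>
  Moving \<open>c\<close> along its ray stays inside the open domain for a while, and absolute convergence
  depends on \<open>c\<close> only through its modulus.\<close>

lemma G3_domain_imp_interior_scaling_radii:
  assumes c: "c \<noteq> 0" and dom: "(x * c, y / c\<^sup>2) \<in> G3_domain A A'"
  shows "cmod c \<in> interior (scaling_radii A A' x y)"
proof -
  let ?S = "{(x, y). (\<lambda>(m, n). norm (G3_term A A' x y m n)) summable_on UNIV}"
  define u where "u = c / of_real (cmod c)"
  let ?g = "\<lambda>r :: real. (x * (of_real r * u), y / (of_real r * u)\<^sup>2)"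
  have u: "cmod u = 1" "u \<noteq> 0"
    using c by (auto simp: u_def norm_divide)
  have "?g (cmod c) \<in> interior ?S"
    using dom c by (simp add: u_def G3_domain_def)
  moreover have "continuous_on {0<..} ?g"
    using u by (intro continuous_intros) auto
  ultimately have "open ({0<..} \<inter> ?g -` interior ?S)" "cmod c \<in> {0<..} \<inter> ?g -` interior ?S"
    using c by (auto intro: continuous_open_preimage)
  moreover have "{0<..} \<inter> ?g -` interior ?S \<subseteq> scaling_radii A A' x y"
  proof
    fix r :: real assume r: "r \<in> {0<..} \<inter> ?g -` interior ?S"
    then have "?g r \<in> ?S"
      using interior_subset by blast
    moreover have "of_real r * u \<noteq> 0"
      using r u by auto
    ultimately show "r \<in> scaling_radii A A' x y"
      using r u by (simp add: scaling_radii_def G3_term_scale norm_mscale norm_power_int norm_mult)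
  qed
  ultimately show ?thesis
    using interiorI by blast
qed

lemma summable_G3_term_scaled:
  assumes "c \<noteq> 0" "cmod c \<in> scaling_radii A A' x y"
  shows "(\<lambda>(m, n). norm (G3_term A A' (x * c) (y / c\<^sup>2) m n)) summable_on UNIV"
  using assms by (simp add: scaling_radii_def G3_term_scale norm_mscale norm_power_int)

lemma G3_has_sum:
  assumes "(\<lambda>(m, n). norm (G3_term A A' x y m n)) summable_on UNIV"
  shows "((\<lambda>(m, n). G3_term A A' x y m n) has_sum G3 A A' x y) UNIV"
  unfolding G3_def
  by (rule has_sum_infsum, rule abs_summable_summable) (use assms in \<open>simp add: case_prod_unfold\<close>)

lemma norm_entry_le: "norm (X $ i $ j) \<le> norm X"
  using Finite_Cartesian_Product.norm_nth_le[of "X $ i" j]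
    Finite_Cartesian_Product.norm_nth_le[of X i] by linarith

text \<open>
  On a closed disc inside the annulus the terms are dominated by their values on two bounding radii,
  so the partial sums converge uniformly.\<close>

lemma G3_scaled_entry_holomorphic:
  assumes J: "open J" "J \<subseteq> scaling_radii A A' x y"
  shows "(\<lambda>s. G3 A A' (x * (1 - s)) (y / (1 - s)\<^sup>2) $ i $ j) holomorphic_on {s. cmod (1 - s) \<in> J}"
proof (rule analytic_imp_holomorphic, unfold analytic_on_def, rule ballI)
  fix z assume "z \<in> {s. cmod (1 - s) \<in> J}"
  then obtain e where e: "e > 0" "ball (cmod (1 - z)) e \<subseteq> J"
    using J(1) by (auto simp: open_contains_ball)
  define p where "p = cmod (1 - z) - e / 2"
  define q where "q = cmod (1 - z) + e / 2"
  let ?T = "\<lambda>(m, n). G3_term A A' x y m n"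
  let ?e = "\<lambda>(m, n). int m - 2 * int n"
  let ?f = "\<lambda>k s. (1 - s) powi ?e k * ?T k $ i $ j"
  let ?F = "\<lambda>s. G3 A A' (x * (1 - s)) (y / (1 - s)\<^sup>2) $ i $ j"
  let ?B = "cball z (e / 2)"
  have pq: "p \<in> scaling_radii A A' x y" "q \<in> scaling_radii A A' x y"
    using e J(2) by (auto simp: p_def q_def subset_iff dist_real_def)
  have p: "0 < p"
    using pq(1) by (simp add: scaling_radii_def)
  have annulus: "p \<le> cmod (1 - s)" "cmod (1 - s) \<le> q" if "s \<in> ?B" for s
    using that norm_triangle_ineq3[of "1 - s" "1 - z"]
    by (auto simp: p_def q_def dist_norm abs_le_iff)
  have nz: "1 - s \<noteq> 0" if "s \<in> ?B" for s
    using annulus(1)[OF that] p by auto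
  have radius: "cmod (1 - s) \<in> scaling_radii A A' x y" if "s \<in> ?B" for s
    using is_interval_scaling_radii[of A A' x y] pq annulus[OF that] unfolding is_interval_1 by blast
  have limit: "uniform_limit ?B (\<lambda>X s. \<Sum>k\<in>X. ?f k s) ?F (finite_subsets_at_top UNIV)"
  proof (rule Weierstrass_m_test_general')
    fix k s assume s: "s \<in> ?B"
    have "norm (?f k s) \<le> cmod (1 - s) powi ?e k * norm (?T k)"
      unfolding norm_mult norm_power_int
      by (intro mult_left_mono norm_entry_le) auto
    also have "\<dots> \<le> (p powi ?e k + q powi ?e k) * norm (?T k)"
      by (intro mult_right_mono power_int_le_add_endpoints p annulus s) auto
    finally show "norm (?f k s) \<le> (p powi ?e k + q powi ?e k) * norm (?T k)" .
  next
    fix s assume s: "s \<in> ?B"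
    have "((\<lambda>k. ((1 - s) powi ?e k *\<^sub>M ?T k) $ i $ j) has_sum ?F s) UNIV"
      using G3_has_sum[OF summable_G3_term_scaled[OF nz[OF s] radius[OF s]]]
      by (intro has_sum_bounded_linear[OF bounded_linear_vec_nth])
         (simp add: G3_term_scale[OF nz[OF s]] case_prod_unfold)
    then show "((\<lambda>k. ?f k s) has_sum ?F s) UNIV"
      by simp
  next
    have "(\<lambda>k. p powi ?e k * norm (?T k) + q powi ?e k * norm (?T k)) summable_on UNIV"
      using pq by (intro summable_on_add) (auto simp: scaling_radii_def case_prod_unfold)
    then show "(\<lambda>k. (p powi ?e k + q powi ?e k) * norm (?T k)) summable_on UNIV"
      by (simp add: algebra_simps)
  qed
  have partial: "\<forall>\<^sub>F X in finite_subsets_at_top UNIV. continuous_on ?B (\<lambda>s. \<Sum>k\<in>X. ?f k s) \<and>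
      (\<lambda>s. \<Sum>k\<in>X. ?f k s) holomorphic_on ball z (e / 2)"
  proof (rule always_eventually, rule allI)
    fix X :: "(nat \<times> nat) set"
    have "(\<lambda>s. \<Sum>k\<in>X. ?f k s) holomorphic_on ?B"
      using nz by (intro holomorphic_intros) auto
    then show "continuous_on ?B (\<lambda>s. \<Sum>k\<in>X. ?f k s) \<and>
        (\<lambda>s. \<Sum>k\<in>X. ?f k s) holomorphic_on ball z (e / 2)"
      using holomorphic_on_imp_continuous_on holomorphic_on_subset ball_subset_cball by blast
  qed
  have "?F holomorphic_on ball z (e / 2)"
    by (rule holomorphic_uniform_limit[OF partial limit finite_subsets_at_top_neq_bot])
  then show "\<exists>\<epsilon>>0. ?F holomorphic_on ball z \<epsilon>"
    using e(1) by (intro exI[of _ "e / 2"] conjI) simp_all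
qed

section \<open>Expansion near the origin\<close>

text \<open>
  The factors \<open>(A + k)\<^sub>j\<close> and \<open>(A)\<^sub>j\<close>, with \<open>j = 2 n - m\<close>, stand leftmost in the two terms, which is
  why the shift is exchanged by multiplication from the left.\<close>

lemma G3_shift_term:
  assumes A: "mpoch_defined A" and Ak: "mpoch_defined (A + mat (of_nat k))"
  shows "mpoch_nat A k ** G3_term (A + mat (of_nat k)) A' x y m n
     = mpoch_nat (A + mat (of_int (2 * int n - int m))) k ** G3_term A A' x y m n"
  using mpoch_nat_mult_mpoch_shift[OF A Ak, of "2 * int n - int m"]
  unfolding G3_term_def mscale_mult_right by (simp only: matrix_mul_assoc)

text \<open>
  For small \<open>s\<close> the triple series of the \<open>(s\<^sup>k / k!) (A + j)\<^sub>k T\<^sub>m\<^sub>n\<close>, with \<open>j = 2 n - m\<close> and \<open>T\<^sub>m\<^sub>n\<close>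
  the terms of \<open>G\<^sub>3(A, A'; x, y)\<close>, converges absolutely: summation over \<open>k\<close> costs at most a
  constant times \<open>r\<^sup>-\<^sup>|\<^sup>j\<^sup>|\<close> with \<open>r = 1 - |s|\<close>, and for small \<open>s\<close> both \<open>r\<close> and \<open>1 / r\<close> are
  admissible radii. Summing over \<open>k\<close> first gives \<open>(1 - s)\<^sup>-\<^sup>A (1 - s)\<^sup>-\<^sup>j T\<^sub>m\<^sub>n\<close>, hence the closed form;
  summing over \<open>(m, n)\<close> first gives the shifted series.\<close>

lemma G3_expansion_at_0:
  fixes A A' :: "complex^'d^'d"
  assumes def: "\<And>n::nat. mpoch_defined (A + mat (of_nat n))"
    and one: "1 \<in> interior (scaling_radii A A' x y)"
  shows "\<exists>\<delta>>0. \<forall>s. cmod s < \<delta> \<longrightarrow>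
    (\<lambda>k. s ^ k *\<^sub>M (((1 / fact k) *\<^sub>M mpoch_nat A k) ** G3 (A + mat (of_nat k)) A' x y)) sums
      (one_minus_pow_neg s A ** G3 A A' (x * (1 - s)) (y / (1 - s)\<^sup>2))"
proof -
  let ?T = "\<lambda>(m, n). G3_term A A' x y m n"
  let ?j = "\<lambda>(m, n). 2 * int n - int m"
  let ?I = "mat 1 :: complex^'d^'d"
  obtain e where e: "e > 0" "ball 1 e \<subseteq> scaling_radii A A' x y"
    using one by (auto simp: mem_interior)
  define \<delta> where "\<delta> = min (1 / 2) (e / 4)"
  have \<delta>: "0 < \<delta>" "\<delta> \<le> 1 / 2" "\<delta> \<le> e / 4"
    using e by (auto simp: \<delta>_def)
  have main: "(\<lambda>k. s ^ k *\<^sub>M (((1 / fact k) *\<^sub>M mpoch_nat A k) ** G3 (A + mat (of_nat k)) A' x y)) sums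
      (one_minus_pow_neg s A ** G3 A A' (x * (1 - s)) (y / (1 - s)\<^sup>2))"
    if s: "cmod s < \<delta>" for s
  proof -
    define \<sigma> where "\<sigma> = cmod s"
    define r where "r = 1 - \<sigma>"
    have s1: "cmod s < 1"
      using s \<delta> by simp
    have r: "1 / 2 < r" "r \<le> 1" "r \<in> scaling_radii A A' x y" "1 / r \<in> scaling_radii A A' x y"
    proof -
      show "1 / 2 < r" "r \<le> 1"
        using s \<delta> by (auto simp: r_def \<sigma>_def)
      moreover have "1 / r - 1 < e"
      proof -
        have "1 / r - 1 = \<sigma> / r"
          using \<open>1 / 2 < r\<close> by (simp add: r_def field_simps)
        also have "\<dots> \<le> \<sigma> / (1 / 2)"
          using \<open>1 / 2 < r\<close> by (intro divide_left_mono) (auto simp: \<sigma>_def)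
        also have "\<dots> < e"
          using s \<delta> e by (simp add: \<sigma>_def)
        finally show ?thesis .
      qed
      moreover have "1 \<le> 1 / r"
        using \<open>1 / 2 < r\<close> \<open>r \<le> 1\<close> by simp
      moreover have "\<sigma> < e"
        using s \<delta> e by (simp add: \<sigma>_def)
      ultimately show "r \<in> scaling_radii A A' x y" "1 / r \<in> scaling_radii A A' x y"
        using e(2) by (auto simp: subset_iff dist_real_def r_def \<sigma>_def)
    qed
    \<comment> \<open>\<open>W\<close> is the triple series, \<open>B\<close> its majorant; \<open>i\<close> stands for the pair \<open>(m, n)\<close>\<close>
    define W where "W = (\<lambda>(i, k). ((s ^ k / fact k) *\<^sub>M mpoch_nat (A + mat (of_int (?j i))) k) ** ?T i)"
    define B where "B = (\<lambda>(i, k). norm ?I * (pochhammer (norm A + \<bar>real_of_int (?j i)\<bar>) k / fact k * \<sigma> ^ k) * norm (?T i))"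
    have B_nonneg: "0 \<le> B (i, k)" for i k
      unfolding B_def prod.case \<sigma>_def
      by (rule mult_nonneg_nonneg[OF order_trans[OF norm_ge_zero
            norm_power_series_term_le[of s k A "of_int (?j i)", unfolded norm_of_int]] norm_ge_zero])
    have B_sum: "((\<lambda>k. B (i, k)) has_sum norm ?I * r powr (- (norm A + \<bar>real_of_int (?j i)\<bar>)) * norm (?T i)) UNIV" for i
    proof -
      have "\<bar>\<sigma>\<bar> < 1"
        using s1 by (simp add: \<sigma>_def)
      then have "(\<lambda>k. B (i, k)) sums (norm ?I * r powr (- (norm A + \<bar>real_of_int (?j i)\<bar>)) * norm (?T i))"
        unfolding B_def r_def prod.case by (intro sums_mult sums_mult2 sums_pochhammer_powr)
      then show ?thesis
        by (rule sums_nonneg_imp_has_sum) (rule B_nonneg)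
    qed
    have "B summable_on (UNIV \<times> UNIV)"
    proof (rule summable_on_SigmaI[OF B_sum])
      have sm: "(\<lambda>i. norm ?I * r powr (- norm A) * ((1 / r) powi (- ?j i) * norm (?T i) + r powi (- ?j i) * norm (?T i))) summable_on UNIV"
        using r(3,4) by (intro summable_on_cmult_right summable_on_add)
          (auto simp: scaling_radii_def case_prod_unfold)
      show "(\<lambda>i. norm ?I * r powr (- (norm A + \<bar>real_of_int (?j i)\<bar>)) * norm (?T i)) summable_on UNIV"
      proof (rule summable_on_comparison_test[OF sm])
        fix i :: "nat \<times> nat"
        have "r powr (- \<bar>real_of_int (?j i)\<bar>) \<le> (1 / r) powi (- ?j i) + r powi (- ?j i)"
        proof (cases "0 \<le> ?j i")
          case True
          then have "r powr (- \<bar>real_of_int (?j i)\<bar>) = r powi (- ?j i)"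
            using r by (simp add: powr_real_of_int' flip: of_int_minus)
          then show ?thesis
            using r by simp
        next
          case False
          then have "r powr (- \<bar>real_of_int (?j i)\<bar>) = r powi (?j i)"
            using r by (simp add: powr_real_of_int')
          also have "\<dots> = (1 / r) powi (- ?j i)"
            by (simp add: power_int_minus power_int_divide_distrib)
          finally show ?thesis
            using r by simp
        qed
        then have "norm ?I * r powr (- norm A) * (r powr (- \<bar>real_of_int (?j i)\<bar>) * norm (?T i))
          \<le> norm ?I * r powr (- norm A) * (((1 / r) powi (- ?j i) + r powi (- ?j i)) * norm (?T i))"
          by (intro mult_left_mono mult_right_mono) auto
        moreover have "r powr (- (norm A + \<bar>real_of_int (?j i)\<bar>))
            = r powr (- norm A) * r powr (- \<bar>real_of_int (?j i)\<bar>)"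
          by (simp flip: powr_add)
        ultimately show "norm ?I * r powr (- (norm A + \<bar>real_of_int (?j i)\<bar>)) * norm (?T i)
          \<le> norm ?I * r powr (- norm A) * ((1 / r) powi (- ?j i) * norm (?T i) + r powi (- ?j i) * norm (?T i))"
          by (simp only: mult.assoc distrib_right)
      qed auto
    qed (rule B_nonneg)
    then have W_abs: "(\<lambda>p. norm (W p)) summable_on (UNIV \<times> UNIV)"
    proof (rule summable_on_comparison_test)
      fix p :: "(nat \<times> nat) \<times> nat"
      obtain i k where p: "p = (i, k)" by fastforce
      have "norm (W p) \<le> norm ((s ^ k / fact k) *\<^sub>M mpoch_nat (A + mat (of_int (?j i))) k) * norm (?T i)"
        unfolding W_def p prod.case by (rule norm_matrix_mult_le)
      also have "\<dots> \<le> B p"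
        unfolding B_def p prod.case \<sigma>_def
        by (rule mult_right_mono[OF norm_power_series_term_le[of s k A "of_int (?j i)", unfolded norm_of_int]
              norm_ge_zero])
      finally show "norm (W p) \<le> B p" .
    qed auto
    then have W_sum: "W summable_on (UNIV \<times> UNIV)"
      by (rule abs_summable_summable)
    have inner: "((\<lambda>k. W (i, k)) has_sum one_minus_pow_neg s A ** ((1 - s) powi (- ?j i) *\<^sub>M ?T i)) UNIV" for i
    proof -
      let ?M = "A + mat (of_int (?j i))"
      have "((\<lambda>k. (s ^ k / fact k) *\<^sub>M mpoch_nat ?M k) has_sum one_minus_pow_neg s ?M) UNIV"
        by (rule norm_summable_imp_has_sum[OF one_minus_pow_neg_sums[OF s1]])
      then have "((\<lambda>k. W (i, k)) has_sum one_minus_pow_neg s ?M ** ?T i) UNIV"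
        unfolding W_def prod.case
        by (rule has_sum_bounded_linear[OF bounded_bilinear.bounded_linear_left[OF bounded_bilinear_matrix_mult]])
      then show ?thesis
        by (simp add: one_minus_pow_neg_plus_int[OF s1])
    qed
    have "1 - s \<noteq> 0"
      using s1 by auto
    have "\<bar>1 - cmod (1 - s)\<bar> < e"
      using norm_triangle_ineq3[of 1 "1 - s"] s \<delta> by simp
    then have "cmod (1 - s) \<in> scaling_radii A A' x y"
      using e(2) by (auto simp: subset_iff dist_real_def)
    then have "((\<lambda>(m, n). G3_term A A' (x * (1 - s)) (y / (1 - s)\<^sup>2) m n) has_sum
        G3 A A' (x * (1 - s)) (y / (1 - s)\<^sup>2)) UNIV"
      by (intro G3_has_sum summable_G3_term_scaled \<open>1 - s \<noteq> 0\<close>)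
    then have "((\<lambda>i. (1 - s) powi (- ?j i) *\<^sub>M ?T i) has_sum G3 A A' (x * (1 - s)) (y / (1 - s)\<^sup>2)) UNIV"
      by (simp add: G3_term_scale[OF \<open>1 - s \<noteq> 0\<close>] case_prod_unfold)
    then have outer: "((\<lambda>i. one_minus_pow_neg s A ** ((1 - s) powi (- ?j i) *\<^sub>M ?T i)) has_sum
        one_minus_pow_neg s A ** G3 A A' (x * (1 - s)) (y / (1 - s)\<^sup>2)) UNIV"
      by (rule has_sum_bounded_linear[OF bounded_bilinear.bounded_linear_right[OF bounded_bilinear_matrix_mult]])
    let ?S = "one_minus_pow_neg s A ** G3 A A' (x * (1 - s)) (y / (1 - s)\<^sup>2)"
    have "infsum W (UNIV \<times> UNIV) = ?S"
      by (rule has_sum_unique[OF has_sum_SigmaD[OF has_sum_infsum[OF W_sum] inner] outer])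
    then have "(W has_sum ?S) UNIV"
      using has_sum_infsum[OF W_sum] by simp
    then have total: "((\<lambda>(k, i). W (i, k)) has_sum ?S) (UNIV \<times> UNIV)"
      using has_sum_reindex_bij_betw[OF bij_swap, of W ?S] by (simp add: case_prod_unfold prod.swap_def)
    have W_abs': "(\<lambda>(k, i). norm (W (i, k))) summable_on (UNIV \<times> UNIV)"
      using W_abs summable_on_reindex_bij_betw[OF bij_swap, of "\<lambda>p. norm (W p)"]
      by (simp add: case_prod_unfold prod.swap_def)
    have column: "((\<lambda>i. W (i, k)) has_sum
        s ^ k *\<^sub>M (((1 / fact k) *\<^sub>M mpoch_nat A k) ** G3 (A + mat (of_nat k)) A' x y)) UNIV" for k
    proof -
      let ?Tk = "\<lambda>(m, n). G3_term (A + mat (of_nat k)) A' x y m n"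
      let ?h = "\<lambda>X. (s ^ k / fact k) *\<^sub>M (mpoch_nat A k ** X)"
      have A0: "mpoch_defined A"
        using def[of 0] by simp
      have W_eq: "W (i, k) = ?h (?Tk i)" for i
        using G3_shift_term[OF A0 def[of k], of A' x y "fst i" "snd i"]
        by (simp add: W_def case_prod_unfold)
      have h: "bounded_linear ?h"
        by (intro bounded_linear_compose[OF bounded_linear_mscale]
            bounded_bilinear.bounded_linear_right[OF bounded_bilinear_matrix_mult])
      have "((\<lambda>i. ?h (?Tk i)) has_sum ?h (G3 (A + mat (of_nat k)) A' x y)) UNIV"
      proof (cases "s ^ k = 0")
        case True
        then show ?thesis
          by (simp only: True div_0 mscale_zero has_sum_0_simp)
      next
        case False
        \<comment> \<open>undoing the invertible factor transfers summability to the shifted series\<close>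
        let ?g = "\<lambda>X. (fact k / s ^ k) *\<^sub>M (matrix_inv (mpoch_nat A k) ** X)"
        have g: "bounded_linear ?g"
          by (intro bounded_linear_compose[OF bounded_linear_mscale]
              bounded_bilinear.bounded_linear_right[OF bounded_bilinear_matrix_mult])
        have gh: "?g (?h X) = X" for X
          using False invertible_matrix_inv(2)[OF invertible_mpoch_nat[OF def[of k]]]
          by (simp add: matrix_mul_assoc)
        have "(\<lambda>i. norm (W (i, k))) summable_on UNIV"
          by (rule summable_on_SigmaD1[where f = "\<lambda>k i. norm (W (i, k))", OF W_abs']) simp
        then have "(\<lambda>i. W (i, k)) summable_on UNIV"
          by (rule abs_summable_summable)
        then have "(\<lambda>i. ?g (?h (?Tk i))) summable_on UNIV"
          unfolding W_eq by (rule summable_on_bounded_linear[OF g])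
        then have "?Tk summable_on UNIV"
          unfolding gh .
        then show ?thesis
          unfolding G3_def by (rule has_sum_bounded_linear[OF h has_sum_infsum])
      qed
      moreover have "?h X = s ^ k *\<^sub>M (((1 / fact k) *\<^sub>M mpoch_nat A k) ** X)" for X
        by simp
      ultimately show ?thesis
        unfolding W_eq by (simp only:)
    qed
    have "((\<lambda>k. s ^ k *\<^sub>M (((1 / fact k) *\<^sub>M mpoch_nat A k) ** G3 (A + mat (of_nat k)) A' x y)) has_sum
        one_minus_pow_neg s A ** G3 A A' (x * (1 - s)) (y / (1 - s)\<^sup>2)) UNIV"
      by (rule has_sum_SigmaD[OF total]) (simp only: prod.case column)
    then show ?thesis
      by (rule has_sum_imp_sums)
  qed
  then show ?thesis
    using \<delta>(1) by blast
qed

section \<open>Power series at the boundary of the disc of convergence\<close>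

text \<open>
  A power series that converges at a boundary point takes there its radial limit. Summation by parts
  replaces the terms by the remainders \<open>R\<^sub>n\<close>, which tend to zero, so that
  \<open>(1 - r) (\<Sum>n. R\<^sub>n\<^sub>+\<^sub>1 r\<^sup>n)\<close> tends to zero as \<open>r\<close> increases to 1.\<close>

theorem Abel_limit_theorem:
  fixes b :: "nat \<Rightarrow> complex"
  assumes "summable b"
  shows "((\<lambda>r. \<Sum>n. b n * of_real r ^ n) \<longlongrightarrow> suminf b) (at_left 1)"
proof -
  define R where "R n = suminf b - (\<Sum>k<n. b k)" for n
  have R_lim: "R \<longlonglongrightarrow> 0"
    using tendsto_diff[OF tendsto_const[of "suminf b"] summable_LIMSEQ[OF assms]]
    by (simp add: R_def[abs_def])
  then obtain C where C: "norm (R n) \<le> C" for n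
    using Bseq_def convergent_imp_Bseq convergentI by metis
  have R_sum: "summable (\<lambda>n. norm (R (n + i) * of_real r ^ n))" if "0 \<le> r" "r < 1" for r i
    by (rule summable_comparison_test'[where g = "\<lambda>n. C * r ^ n" and N = 0])
       (use that C in \<open>auto simp: norm_mult norm_power summable_geometric intro!: summable_mult mult_right_mono\<close>)
  \<comment> \<open>summation by parts: the terms are the differences of the remainders\<close>
  have parts: "suminf b - (\<Sum>n. b n * of_real r ^ n) = of_real (1 - r) * (\<Sum>n. R (n + 1) * of_real r ^ n)"
    if r: "0 \<le> r" "r < 1" for r
  proof -
    have s0: "(\<lambda>n. R n * of_real r ^ n) sums (\<Sum>n. R n * of_real r ^ n)"
      and s1: "(\<lambda>n. R (n + 1) * of_real r ^ n) sums (\<Sum>n. R (n + 1) * of_real r ^ n)"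
      using summable_norm_cancel[OF R_sum[OF r, of 0]] summable_norm_cancel[OF R_sum[OF r, of 1]]
      by (auto intro: summable_sums)
    have "(\<lambda>n. R n * of_real r ^ n - R (n + 1) * of_real r ^ n)
        sums ((\<Sum>n. R n * of_real r ^ n) - (\<Sum>n. R (n + 1) * of_real r ^ n))"
      by (rule sums_diff[OF s0 s1])
    moreover have "R n * of_real r ^ n - R (n + 1) * of_real r ^ n = b n * of_real r ^ n" for n
      by (simp add: R_def algebra_simps)
    ultimately have diff: "(\<Sum>n. b n * of_real r ^ n) = (\<Sum>n. R n * of_real r ^ n) - (\<Sum>n. R (n + 1) * of_real r ^ n)"
      by (simp add: sums_iff)
    have shifted: "(\<lambda>n. R (Suc n) * of_real r ^ Suc n) sums ((\<Sum>n. R n * of_real r ^ n) - R 0)"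
      unfolding sums_Suc_iff[where f = "\<lambda>n. R n * of_real r ^ n"] using s0 by simp
    have "(\<lambda>n. R (Suc n) * of_real r ^ Suc n) sums (of_real r * (\<Sum>n. R (n + 1) * of_real r ^ n))"
      using sums_mult[OF s1, of "of_real r"] by (simp add: mult_ac)
    then have "(\<Sum>n. R n * of_real r ^ n) - R 0 = of_real r * (\<Sum>n. R (n + 1) * of_real r ^ n)"
      by (rule sums_unique2[OF shifted])
    moreover have "R 0 = suminf b"
      by (simp add: R_def)
    ultimately show ?thesis
      unfolding diff by (simp add: algebra_simps)
  qed
  show ?thesis
  proof (rule tendstoI)
    fix e :: real assume e: "0 < e"
    obtain N where N: "norm (R n) \<le> e / 2" if "n \<ge> N" for n
      using LIMSEQ_D[OF R_lim, of "e / 2"] e by (metis diff_zero half_gt_zero less_imp_le)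
    define K where "K = (\<Sum>n<N. norm (R (n + 1)))"
    have bound: "dist (\<Sum>n. b n * of_real r ^ n) (suminf b) \<le> (1 - r) * K + e / 2"
      if r: "0 < r" "r < 1" for r
    proof -
      have g: "(\<lambda>n. (if n < N then norm (R (n + 1)) else 0) + e / 2 * r ^ n)
          sums (K + e / 2 * (1 / (1 - r)))"
        unfolding K_def lessThan_def
        using r by (intro sums_add sums_mult geometric_sums sums_If_finite) auto
      have le: "norm (R (n + 1) * of_real r ^ n) \<le> (if n < N then norm (R (n + 1)) else 0) + e / 2 * r ^ n" for n
      proof (cases "n < N")
        case True
        have "norm (R (n + 1)) * r ^ n \<le> norm (R (n + 1))"
          using r by (intro mult_left_le power_le_one) auto
        moreover have "0 \<le> e / 2 * r ^ n"
          using r e by simp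
        ultimately show ?thesis
          using True r by (simp add: norm_mult norm_power)
      next
        case False
        then show ?thesis
          using r N[of "n + 1"] by (simp add: norm_mult norm_power mult_right_mono)
      qed
      have "norm (\<Sum>n. R (n + 1) * of_real r ^ n) \<le> (\<Sum>n. norm (R (n + 1) * of_real r ^ n))"
        by (rule summable_norm[OF R_sum]) (use r in auto)
      also have "\<dots> \<le> K + e / 2 * (1 / (1 - r))"
        unfolding sums_unique[OF g]
        by (rule suminf_le[OF le]) (use r g R_sum[of r 1] in \<open>auto simp: sums_iff\<close>)
      finally have "(1 - r) * norm (\<Sum>n. R (n + 1) * of_real r ^ n) \<le> (1 - r) * (K + e / 2 * (1 / (1 - r)))"
        using r by (intro mult_left_mono) auto
      also have "\<dots> = (1 - r) * K + e / 2"
        using r by (simp add: field_simps)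
      finally have "(1 - r) * norm (\<Sum>n. R (n + 1) * of_real r ^ n) \<le> (1 - r) * K + e / 2" .
      moreover have "dist (\<Sum>n. b n * of_real r ^ n) (suminf b)
          = norm (of_real (1 - r) * (\<Sum>n. R (n + 1) * of_real r ^ n))"
        using parts[of r] r by (simp add: dist_norm norm_minus_commute)
      moreover have "norm (of_real (1 - r) * (\<Sum>n. R (n + 1) * of_real r ^ n))
          = (1 - r) * norm (\<Sum>n. R (n + 1) * of_real r ^ n)"
        using r by (simp add: norm_mult del: of_real_diff)
      ultimately show ?thesis
        by simp
    qed
    have "((\<lambda>r. (1 - r) * K + e / 2) \<longlongrightarrow> (1 - 1) * K + e / 2) (at_left 1)"
      by (intro tendsto_intros)
    then have "\<forall>\<^sub>F r in at_left 1. (1 - r) * K + e / 2 < e"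
      by (rule order_tendstoD(2)) (use e in simp)
    moreover have "\<forall>\<^sub>F r in at_left (1::real). 0 < r \<and> r < 1"
      by (rule eventually_at_leftI[of 0]) auto
    ultimately show "\<forall>\<^sub>F r in at_left 1. dist (\<Sum>n. b n * of_real r ^ n) (suminf b) < e"
      by eventually_elim (use bound in fastforce)
  qed
qed

text \<open>
  The disc has centre 0 and the annulus centre 1. Turning a point \<open>1 - r cis \<theta>\<close> about 1 towards the
  real axis decreases its distance from 0, and so does moving from \<open>1 - r\<close> to 0 along the real axis;
  both motions stay inside the set.\<close>

lemma connected_disc_Int_annulus:
  assumes J: "is_interval J" "1 \<in> J" and "0 < \<rho>" "\<rho> \<le> 1"
  shows "connected {s. cmod s < \<rho> \<and> cmod (1 - s) \<in> J}" (is "connected ?S")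
proof -
  have "connected_component ?S 0 s" if s: "s \<in> ?S" for s
  proof -
    define r where "r = cmod (1 - s)"
    define \<theta> where "\<theta> = Arg (1 - s)"
    have rJ: "r \<in> J"
      using s by (simp add: r_def)
    have s_eq: "s = 1 - of_real r * cis \<theta>"
      using rcis_cmod_Arg[of "1 - s"] by (simp add: r_def \<theta>_def rcis_def)
    have norm_arc: "(cmod (1 - of_real r * cis \<phi>))\<^sup>2 = 1 + r\<^sup>2 - 2 * r * cos \<phi>" for \<phi>
      unfolding cmod_power2 by (simp add: power2_eq_square algebra_simps)
        (metis (no_types) distrib_left mult.commute mult.left_commute mult.right_neutral
          power2_eq_square sin_cos_squared_add add.commute)
    have less: "cmod (1 - of_real r * cis \<phi>) < \<rho>" if "\<bar>\<phi>\<bar> \<le> \<bar>\<theta>\<bar>" for \<phi>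
    proof -
      have "\<bar>\<theta>\<bar> \<le> pi"
        using Arg_bounded[of "1 - s"] by (simp add: \<theta>_def abs_le_iff)
      then have "cos \<theta> \<le> cos \<phi>"
        using cos_monotone_0_pi_le[of "\<bar>\<phi>\<bar>" "\<bar>\<theta>\<bar>"] that by simp
      then have "(cmod (1 - of_real r * cis \<phi>))\<^sup>2 \<le> (cmod s)\<^sup>2"
        unfolding s_eq norm_arc by (simp add: mult_left_mono r_def)
      then show ?thesis
        using s by (simp add: power2_le_iff_abs_le)
    qed
    let ?arc = "(\<lambda>\<tau>. 1 - of_real r * cis (\<tau> * \<theta>)) ` {0..1}"
    have "connected ?arc"
      by (intro connected_continuous_image continuous_intros) auto
    moreover have "?arc \<subseteq> ?S"
    proof clarify
      fix \<tau> :: real assume \<tau>: "\<tau> \<in> {0..1}"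
      have "\<bar>\<tau> * \<theta>\<bar> \<le> \<bar>\<theta>\<bar>"
        using \<tau> by (simp add: abs_mult mult_left_le_one_le)
      moreover have "cmod (1 - (1 - of_real r * cis (\<tau> * \<theta>))) = r"
        by (simp add: norm_mult r_def)
      ultimately show "cmod (1 - of_real r * cis (\<tau> * \<theta>)) < \<rho> \<and> cmod (1 - (1 - of_real r * cis (\<tau> * \<theta>))) \<in> J"
        using less rJ by simp
    qed
    moreover have "s \<in> ?arc"
      by (rule image_eqI[where x = 1]) (use s_eq in auto)
    moreover have "1 - of_real r \<in> ?arc"
      by (rule image_eqI[where x = 0]) auto
    ultimately have 1: "connected_component ?S (1 - of_real r) s"
      by (intro connected_componentI)
    let ?seg = "(\<lambda>u. 1 - of_real u :: complex) ` closed_segment 1 r"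
    have "connected ?seg"
      by (intro connected_continuous_image continuous_intros) auto
    moreover have "?seg \<subseteq> ?S"
    proof clarify
      fix u :: real assume u: "u \<in> closed_segment 1 r"
      then have "u \<in> J"
        using closed_segment_subset[of 1 J r] J rJ is_interval_convex_1 by blast
      moreover have "u \<ge> 0"
        using u by (auto simp: closed_segment_eq_real_ivl r_def split: if_splits intro: order_trans[of 0 "cmod (1 - s)"])
      moreover have "\<bar>1 - u\<bar> \<le> \<bar>1 - r\<bar>"
        using u by (auto simp: closed_segment_eq_real_ivl split: if_splits)
      moreover have "\<bar>1 - r\<bar> < \<rho>"
        using less[of 0] by (metis abs_ge_zero abs_zero cis_zero mult.right_neutral norm_of_real of_real_1 of_real_diff)
      moreover have "cmod (1 - of_real u) = \<bar>1 - u\<bar>"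
        by (metis norm_of_real of_real_1 of_real_diff)
      ultimately show "cmod (1 - of_real u) < \<rho> \<and> cmod (1 - (1 - of_real u)) \<in> J"
        by simp
    qed
    ultimately have 2: "connected_component ?S 0 (1 - of_real r)"
      by (rule connected_componentI) (auto intro!: image_eqI[where x = 1] image_eqI[where x = r])
    show ?thesis
      by (rule connected_component_trans[OF 2 1])
  qed
  then show ?thesis
    unfolding connected_iff_connected_component
    by (blast intro: connected_component_sym connected_component_trans)
qed

lemma open_disc_Int_annulus:
  assumes "open J"
  shows "open {s :: complex. cmod s < \<rho> \<and> cmod (1 - s) \<in> J}"
proof -
  have "open (ball 0 \<rho> \<inter> (\<lambda>s :: complex. cmod (1 - s)) -` J)"
    by (intro open_Int open_ball open_vimage assms continuous_intros)
  also have "ball 0 \<rho> \<inter> (\<lambda>s. cmod (1 - s)) -` J = {s. cmod s < \<rho> \<and> cmod (1 - s) \<in> J}"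
    by auto
  finally show ?thesis .
qed

text \<open>
  The straight segment from 0 to \<open>t\<close> may leave the annulus \<open>cmod (1 - s) \<in> J\<close>, so \<open>h\<close> need not be
  holomorphic along it. The intersection of the annulus with the disc \<open>cmod s < cmod t\<close>, in which the
  power series converges, is connected, however, and contains the segment near its end \<open>t\<close>; the
  identity theorem gives equality there, and Abel's theorem extends it to \<open>t\<close> itself.\<close>

lemma power_series_sums_by_continuation:
  fixes a :: "nat \<Rightarrow> complex"
  assumes J: "open J" "is_interval J" "1 \<in> J"
    and h: "h holomorphic_on {s. cmod s < 1 \<and> cmod (1 - s) \<in> J}"
    and \<delta>: "0 < \<delta>" "\<And>s. cmod s < \<delta> \<Longrightarrow> (\<lambda>k. a k * s ^ k) sums h s"
    and t: "cmod t < 1" "cmod (1 - t) \<in> J"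
    and sm: "summable (\<lambda>k. a k * t ^ k)"
  shows "(\<lambda>k. a k * t ^ k) sums h t"
proof (cases "t = 0")
  case True
  then show ?thesis
    using \<delta>(2)[of t] \<delta>(1) by simp
next
  case False
  define \<rho> where "\<rho> = cmod t"
  let ?U = "{s. cmod s < 1 \<and> cmod (1 - s) \<in> J}"
  let ?V = "{s. cmod s < \<rho> \<and> cmod (1 - s) \<in> J}"
  define P where "P s = (\<Sum>k. a k * s ^ k)" for s
  have \<rho>: "0 < \<rho>" "\<rho> \<le> 1"
    using False t by (auto simp: \<rho>_def)
  have "P holomorphic_on ball 0 \<rho>"
  proof (rule power_series_holomorphic[where a = a])
    fix w :: complex assume "w \<in> ball 0 \<rho>"
    then have "summable (\<lambda>k. a k * w ^ k)"
      using powser_inside[OF sm] by (simp add: \<rho>_def)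
    then show "(\<lambda>k. a k * (w - 0) ^ k) sums P w"
      by (simp add: P_def summable_sums)
  qed
  then have P: "P holomorphic_on ?V"
    by (rule holomorphic_on_subset) auto
  have hV: "h holomorphic_on ?V"
    using \<rho> by (intro holomorphic_on_subset[OF h]) auto
  have V: "open ?V" "connected ?V"
    using \<rho> J by (auto intro: open_disc_Int_annulus connected_disc_Int_annulus)
  have "0 \<in> ?V \<inter> ball 0 \<delta>"
    using \<rho> J \<delta>(1) by simp
  then have ne: "?V \<inter> ball 0 \<delta> \<noteq> {}"
    by blast
  have near: "P s = h s" if "s \<in> ?V \<inter> ball 0 \<delta>" for s
    using that \<delta>(2)[of s] by (simp add: P_def sums_iff)
  have eq: "P s = h s" if "s \<in> ?V" for s
    by (rule analytic_continuation_open[OF open_Int[OF V(1) open_ball] V(1) ne V(2) Int_lower1 P hV near that])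
  have path: "((\<lambda>r. of_real r * t) \<longlongrightarrow> t) (at_left 1)"
    by (rule tendsto_eq_intros refl | simp)+
  have "((\<lambda>r. h (of_real r * t)) \<longlongrightarrow> h t) (at_left 1)"
  proof (rule isCont_tendsto_compose[OF _ path])
    show "isCont h t"
      using holomorphic_on_imp_continuous_on[OF h] t continuous_on_eq_continuous_at[OF open_disc_Int_annulus[OF J(1), of 1]]
      by auto
  qed
  moreover have "\<forall>\<^sub>F r in at_left 1. h (of_real r * t) = (\<Sum>k. (a k * t ^ k) * of_real r ^ k)"
  proof -
    have "\<forall>\<^sub>F r in at_left 1. of_real r * t \<in> {s. cmod s < 2 \<and> cmod (1 - s) \<in> J}"
      by (rule topological_tendstoD[OF path open_disc_Int_annulus[OF J(1)]]) (use t in auto)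
    moreover have "\<forall>\<^sub>F r in at_left (1::real). 0 < r \<and> r < 1"
      by (rule eventually_at_leftI[of 0]) auto
    ultimately show ?thesis
    proof eventually_elim
      case (elim r)
      then have "of_real r * t \<in> ?V"
        using \<rho> by (simp add: norm_mult \<rho>_def)
      then have "h (of_real r * t) = P (of_real r * t)"
        by (rule eq[symmetric])
      then show ?case
        by (simp add: P_def power_mult_distrib mult_ac)
    qed
  qed
  ultimately have "((\<lambda>r. \<Sum>k. (a k * t ^ k) * of_real r ^ k) \<longlongrightarrow> h t) (at_left 1)"
    by (rule Lim_transform_eventually)
  with Abel_limit_theorem[OF sm] have "h t = (\<Sum>k. a k * t ^ k)"
    by (intro tendsto_unique[of "at_left (1::real)"]) auto
  then show ?thesis
    using sm by (simp add: summable_sums)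
qed

text \<open>
  Here the annulus contains a disc of radius larger than \<open>cmod t\<close>, in which the Taylor series of \<open>h\<close>
  converges; its coefficients are the \<open>a k\<close>.\<close>

lemma power_series_summable_by_continuation:
  fixes a :: "nat \<Rightarrow> complex"
  assumes J: "open J" "is_interval J"
    and h: "h holomorphic_on {s. cmod s < 1 \<and> cmod (1 - s) \<in> J}"
    and \<delta>: "0 < \<delta>" "\<And>s. cmod s < \<delta> \<Longrightarrow> (\<lambda>k. a k * s ^ k) sums h s"
    and t: "cmod t < 1" "1 - cmod t \<in> J" "1 + cmod t \<in> J"
  shows "summable (\<lambda>k. a k * t ^ k)"
proof -
  obtain e1 where e1: "e1 > 0" "ball (1 - cmod t) e1 \<subseteq> J"
    using J(1) t(2) open_contains_ball by blast
  obtain e2 where e2: "e2 > 0" "ball (1 + cmod t) e2 \<subseteq> J"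
    using J(1) t(3) open_contains_ball by blast
  define \<epsilon> where "\<epsilon> = Min {e1 / 2, e2 / 2, 1 - cmod t}"
  define \<rho> where "\<rho> = cmod t + \<epsilon>"
  have \<epsilon>: "0 < \<epsilon>" "\<epsilon> < e1" "\<epsilon> < e2" "\<rho> \<le> 1"
    using e1(1) e2(1) t(1) by (auto simp: \<epsilon>_def \<rho>_def min_def)
  have "1 - \<rho> \<in> J" "1 + \<rho> \<in> J"
    using \<epsilon> e1(2) e2(2) by (auto simp: \<rho>_def subset_iff dist_real_def)
  then have "{1 - \<rho>..1 + \<rho>} \<subseteq> J"
    using J(2) unfolding is_interval_1 by (meson atLeastAtMost_iff subsetI)
  moreover have "cmod (1 - s) \<in> {1 - \<rho>..1 + \<rho>}" if "cmod s < \<rho>" for s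
    using that norm_triangle_ineq2[of 1 s] norm_triangle_ineq4[of 1 s] by simp
  ultimately have "h holomorphic_on ball 0 \<rho>"
    using \<epsilon> by (intro holomorphic_on_subset[OF h]) auto
  then have "(\<lambda>n. (deriv ^^ n) h 0 / fact n * (t - 0) ^ n) sums h t"
    by (rule holomorphic_power_series) (use \<epsilon> in \<open>simp add: \<rho>_def\<close>)
  moreover have "h has_fps_expansion Abs_fps a"
    by (rule has_fps_expansionI, rule eventually_mono[OF eventually_nhds_in_open[of "ball 0 \<delta>"]])
       (use \<delta> in auto)
  then have "(deriv ^^ n) h 0 / fact n = a n" for n
    using fps_nth_fps_expansion by fastforce
  ultimately show ?thesis
    by (simp add: sums_iff)
qed

section \<open>The first summation formula\<close>

lemma one_minus_pow_neg_entry_holomorphic: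
  "(\<lambda>s. one_minus_pow_neg s A $ i $ j) holomorphic_on ball 0 1"
proof (rule power_series_holomorphic)
  fix s :: complex assume "s \<in> ball 0 1"
  then have "(\<lambda>n. (s ^ n / fact n) *\<^sub>M mpoch_nat A n) sums one_minus_pow_neg s A"
    by (intro one_minus_pow_neg_sums) simp
  then have "(\<lambda>n. ((s ^ n / fact n) *\<^sub>M mpoch_nat A n) $ i $ j) sums one_minus_pow_neg s A $ i $ j"
    by (rule sums_vec_nth[OF sums_vec_nth])
  then show "(\<lambda>n. (mpoch_nat A n $ i $ j / fact n) * (s - 0) ^ n) sums one_minus_pow_neg s A $ i $ j"
    by (simp add: mult_ac)
qed

lemma sums_matrixI:
  fixes f :: "nat \<Rightarrow> complex^'n^'m"
  assumes "\<And>i j. (\<lambda>k. f k $ i $ j) sums (L $ i $ j)"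
  shows "f sums L"
  using assms unfolding sums_def by (intro vec_tendstoI) (simp add: sum_component)

text \<open>
  Summability at \<open>t\<close> or admissibility of the whole disc are the two ways to continue the expansion
  at 0 up to \<open>t\<close>. All arguments are applied entry by entry.\<close>

lemma G3_left_summation:
  fixes A A' :: "complex^'d^'d"
  assumes t: "cmod t < 1"
    and def: "\<And>n::nat. mpoch_defined (A + mat (of_nat n))"
    and dom: "(x, y) \<in> G3_domain A A'" "(x * (1 - t), y / (1 - t)\<^sup>2) \<in> G3_domain A A'"
  defines "f \<equiv> \<lambda>k. t ^ k *\<^sub>M (((1 / fact k) *\<^sub>M mpoch_nat A k) ** G3 (A + mat (of_nat k)) A' x y)"
  shows "summable f \<Longrightarrow> f sums (one_minus_pow_neg t A ** G3 A A' (x * (1 - t)) (y / (1 - t)\<^sup>2))"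
    and "(\<And>s. cmod s \<le> cmod t \<Longrightarrow> (x * (1 - s), y / (1 - s)\<^sup>2) \<in> G3_domain A A') \<Longrightarrow> summable f"
proof -
  define J where "J = interior (scaling_radii A A' x y)"
  define a where "a i j k = (((1 / fact k) *\<^sub>M mpoch_nat A k) ** G3 (A + mat (of_nat k)) A' x y) $ i $ j" for i j k
  define h where "h i j s = (one_minus_pow_neg s A ** G3 A A' (x * (1 - s)) (y / (1 - s)\<^sup>2)) $ i $ j" for i j s
  have f_entry: "f k $ i $ j = a i j k * t ^ k" for i j k
    by (simp add: f_def a_def mult.commute)
  have J: "open J" "is_interval J" "J \<subseteq> scaling_radii A A' x y"
    using is_interval_scaling_radii[of A A' x y] interior_subset
    by (auto simp: J_def is_interval_convex_1 convex_interior)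
  have "1 - t \<noteq> 0"
    using t by auto
  then have radii: "1 \<in> J" "cmod (1 - t) \<in> J"
    using G3_domain_imp_interior_scaling_radii[of 1 x y A A'] dom
      G3_domain_imp_interior_scaling_radii[of "1 - t" x y A A'] by (auto simp: J_def)
  have h: "h i j holomorphic_on {s. cmod s < 1 \<and> cmod (1 - s) \<in> J}" for i j
  proof -
    let ?U = "{s. cmod s < 1 \<and> cmod (1 - s) \<in> J}"
    have "(\<lambda>s. one_minus_pow_neg s A $ i $ l) holomorphic_on ?U" for l
      by (rule holomorphic_on_subset[OF one_minus_pow_neg_entry_holomorphic]) auto
    moreover have "(\<lambda>s. G3 A A' (x * (1 - s)) (y / (1 - s)\<^sup>2) $ l $ j) holomorphic_on ?U" for l
      by (rule holomorphic_on_subset[OF G3_scaled_entry_holomorphic[OF J(1,3)]]) auto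
    ultimately show ?thesis
      unfolding h_def matrix_matrix_mult_def vec_lambda_beta
      by (intro holomorphic_on_sum holomorphic_on_mult)
  qed
  obtain \<delta> where "0 < \<delta>" and \<delta>: "\<forall>s. cmod s < \<delta> \<longrightarrow>
      (\<lambda>k. s ^ k *\<^sub>M (((1 / fact k) *\<^sub>M mpoch_nat A k) ** G3 (A + mat (of_nat k)) A' x y)) sums
        (one_minus_pow_neg s A ** G3 A A' (x * (1 - s)) (y / (1 - s)\<^sup>2))"
    using G3_expansion_at_0[OF def radii(1)[unfolded J_def]] by blast
  have near: "(\<lambda>k. a i j k * s ^ k) sums h i j s" if "cmod s < \<delta>" for i j s
    using sums_vec_nth[OF sums_vec_nth[OF \<delta>[rule_format, OF that], of i], of j]
    by (simp add: a_def h_def mult.commute)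
  show "f sums (one_minus_pow_neg t A ** G3 A A' (x * (1 - t)) (y / (1 - t)\<^sup>2))" if sm: "summable f"
  proof (rule sums_matrixI)
    fix i j
    have sm': "summable (\<lambda>k. a i j k * t ^ k)"
      using summable_vec_nth[OF summable_vec_nth[OF sm]] unfolding f_entry .
    have "(\<lambda>k. a i j k * t ^ k) sums h i j t"
      by (rule power_series_sums_by_continuation[OF J(1,2) radii(1) h \<open>0 < \<delta>\<close> near t radii(2) sm'])
    then show "(\<lambda>k. f k $ i $ j) sums
        (one_minus_pow_neg t A ** G3 A A' (x * (1 - t)) (y / (1 - t)\<^sup>2)) $ i $ j"
      unfolding f_entry h_def .
  qed
  show "summable f" if disc: "\<And>s. cmod s \<le> cmod t \<Longrightarrow> (x * (1 - s), y / (1 - s)\<^sup>2) \<in> G3_domain A A'"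
  proof -
    \<comment> \<open>the points \<open>s = cmod t\<close> and \<open>s = - cmod t\<close> give the extreme radii\<close>
    have ends: "1 - cmod t \<in> J" "1 + cmod t \<in> J"
    proof -
      have "\<bar>1 - u\<bar> \<in> J" if "\<bar>u\<bar> = cmod t" for u
      proof -
        have "cmod (1 - of_real u) \<in> J"
          unfolding J_def
          by (rule G3_domain_imp_interior_scaling_radii) (use disc[of "of_real u"] that t in auto)
        then show ?thesis
          by (metis norm_of_real of_real_1 of_real_diff)
      qed
      from this[of "cmod t"] this[of "- cmod t"] show "1 - cmod t \<in> J" "1 + cmod t \<in> J"
        using t by simp_all
    qed
    have "summable (\<lambda>k. a i j k * t ^ k)" for i j
      by (rule power_series_summable_by_continuation[OF J(1,2) h \<open>0 < \<delta>\<close> near t ends])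
    then have "f sums (\<chi> i j. \<Sum>k. a i j k * t ^ k)"
      by (intro sums_matrixI) (simp add: f_entry summable_sums)
    then show ?thesis
      by (rule sums_summable)
  qed
qed

section \<open>Transposition\<close>

lemma transpose_add: "transpose (X + Y) = transpose X + transpose Y"
  by (simp add: vec_eq_iff transpose_def)

lemma transpose_diff: "transpose (X - Y) = transpose X - transpose (Y :: 'a::group_add^'n^'m)"
  by (simp add: vec_eq_iff transpose_def)

lemma bounded_linear_transpose: "bounded_linear (transpose :: complex^'n^'m \<Rightarrow> complex^'m^'n)"
  by (intro linear_conv_bounded_linear[THEN iffD1] linearI) (simp_all add: vec_eq_iff transpose_def)

text \<open>
  Transposition reverses the order of the factors, but these commute.\<close>

lemma transpose_mpoch_nat: "transpose (mpoch_nat M n) = mpoch_nat (transpose M) n"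
proof (induction n)
  case (Suc n)
  have "transpose (mpoch_nat M (Suc n)) = mpoch_nat (transpose M + mat (of_nat n)) 1 ** mpoch_nat (transpose M + mat 0) n"
    by (simp add: matrix_transpose_mul transpose_add Suc)
  also have "\<dots> = mpoch_nat (transpose M + mat 0) n ** mpoch_nat (transpose M + mat (of_nat n)) 1"
    by (rule mpoch_nat_shift_commute)
  finally show ?case
    by simp
qed simp

lemma mpoch_defined_transpose:
  assumes "mpoch_defined M"
  shows "mpoch_defined (transpose M)"
  unfolding mpoch_defined_def
proof
  fix n
  have "mpoch_nat (mat 1 - transpose M) n = transpose (mpoch_nat (mat 1 - M) n)"
    by (simp add: transpose_mpoch_nat transpose_diff)
  then show "invertible (mpoch_nat (mat 1 - transpose M) n)"
    using assms unfolding mpoch_defined_def invertible_def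
    by (metis matrix_transpose_mul transpose_mat)
qed

lemma transpose_mpoch:
  assumes "mpoch_defined M"
  shows "transpose (mpoch M k) = mpoch (transpose M) k"
proof (cases "0 \<le> k")
  case True
  then show ?thesis
    by (simp add: mpoch_def transpose_mpoch_nat)
next
  case False
  then obtain n where k: "k = - int n"
    by (metis nonpos_int_cases linear)
  have "mpoch_nat (transpose M + mat (- of_nat n)) n ** transpose (mpoch M (- int n))
      = transpose (mpoch M (- int n) ** mpoch_nat (M + mat (- of_nat n)) n)"
    by (simp only: matrix_transpose_mul transpose_mpoch_nat transpose_add transpose_mat)
  also have "\<dots> = mat 1"
    by (simp add: mpoch_neg(2)[OF assms])
  finally show ?thesis
    unfolding k using mpoch_neg_eqI[OF mpoch_defined_transpose[OF assms]] by metis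
qed

lemma transpose_one_minus_pow_neg:
  assumes "cmod s < 1"
  shows "transpose (one_minus_pow_neg s M) = one_minus_pow_neg s (transpose M)"
proof -
  have "(\<lambda>n. transpose ((s ^ n / fact n) *\<^sub>M mpoch_nat M n)) sums transpose (one_minus_pow_neg s M)"
    by (rule bounded_linear.sums[OF bounded_linear_transpose one_minus_pow_neg_sums(2)[OF assms]])
  then show ?thesis
    unfolding transpose_mscale transpose_mpoch_nat
    by (rule sums_unique2[OF _ one_minus_pow_neg_sums(2)[OF assms]])
qed

context
  fixes A A' :: "complex^'d^'d"
  assumes def: "mpoch_defined A" "mpoch_defined A'"
begin

lemma transpose_G3_term: "transpose (G3_term A A' x y m n) = G3_term (transpose A') (transpose A) y x n m"
  by (simp add: G3_term_def transpose_mscale matrix_transpose_mul transpose_mpoch def mult.commute)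

lemma transpose_G3: "transpose (G3 A A' x y) = G3 (transpose A') (transpose A) y x"
proof -
  let ?T = "\<lambda>(m, n). G3_term A A' x y m n"
  have "(\<lambda>i. transpose (?T i)) summable_on UNIV \<longleftrightarrow> ?T summable_on UNIV"
    using summable_on_bounded_linear[OF bounded_linear_transpose, of ?T UNIV]
      summable_on_bounded_linear[OF bounded_linear_transpose, of "\<lambda>i. transpose (?T i)" UNIV]
    by auto
  then have "transpose (G3 A A' x y) = (\<Sum>\<^sub>\<infinity>i. transpose (?T i))"
    unfolding G3_def by (rule infsum_bounded_linear_strong[OF _ bounded_linear_transpose, symmetric])
  also have "\<dots> = (\<Sum>\<^sub>\<infinity>i. transpose (?T (prod.swap i)))"
    by (rule infsum_reindex_bij_betw[OF bij_swap, symmetric])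
  also have "\<dots> = G3 (transpose A') (transpose A) y x"
    by (simp add: G3_def case_prod_unfold transpose_G3_term)
  finally show ?thesis .
qed

lemma G3_domain_transpose:
  assumes "(x, y) \<in> G3_domain A A'"
  shows "(y, x) \<in> G3_domain (transpose A') (transpose A)"
proof -
  let ?S = "{(x, y). (\<lambda>(m, n). norm (G3_term A A' x y m n)) summable_on UNIV}"
  let ?S' = "{(x, y). (\<lambda>(m, n). norm (G3_term (transpose A') (transpose A) x y m n)) summable_on UNIV}"
  have "(\<lambda>(m, n). norm (G3_term (transpose A') (transpose A) y x m n)) summable_on UNIV" 
    if "(\<lambda>(m, n). norm (G3_term A A' x y m n)) summable_on UNIV" for x y
  proof -
    have "(\<lambda>i. (\<lambda>(m, n). norm (G3_term A A' x y m n)) (prod.swap i)) summable_on UNIV"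
      using that by (simp only: summable_on_reindex_bij_betw[OF bij_swap])
    then show ?thesis
      by (simp add: case_prod_unfold norm_transpose flip: transpose_G3_term)
  qed
  then have "prod.swap ` ?S \<subseteq> ?S'"
    by auto
  moreover have linear: "linear (prod.swap :: complex \<times> complex \<Rightarrow> complex \<times> complex)"
    by (rule linearI) (auto simp: prod.swap_def)
  ultimately have "prod.swap ` interior ?S \<subseteq> interior ?S'"
    using interior_mono interior_bijective_linear_image[OF linear bij_swap] by blast
  then show ?thesis
    using assms by (auto simp: G3_domain_def)
qed

end

section \<open>The two summation formulae\<close>

theorem theorem5p3:
  fixes A A' :: "complex^'d^'d" and x y t :: complex
  assumes "norm t < 1"
  shows
    "((\<forall>n::nat. mpoch_defined (A + mat (of_nat n))) \<and> mpoch_defined A' \<and>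
      (x, y) \<in> G3_domain A A' \<and> (x * (1 - t), y / (1 - t)^2) \<in> G3_domain A A' \<longrightarrow>
      (let f = (\<lambda>n::nat. t ^ n *\<^sub>M
             (((1 / fact n) *\<^sub>M mpoch A (int n)) ** G3 (A + mat (of_nat n)) A' x y)) in
        (summable f \<longrightarrow>
          one_minus_pow_neg t A ** G3 A A' (x * (1 - t)) (y / (1 - t)^2) = (\<Sum>n. f n)) \<and>
        ((\<forall>s. norm s \<le> norm t \<longrightarrow> (x * (1 - s), y / (1 - s)^2) \<in> G3_domain A A') \<longrightarrow>
          summable f)))
     \<and>
     (mpoch_defined A \<and> (\<forall>n::nat. mpoch_defined (A' + mat (of_nat n))) \<and>
      (x, y) \<in> G3_domain A A' \<and> (x / (1 - t)^2, y * (1 - t)) \<in> G3_domain A A' \<longrightarrow>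
      (let f = (\<lambda>n::nat. t ^ n *\<^sub>M
             (G3 A (A' + mat (of_nat n)) x y ** ((1 / fact n) *\<^sub>M mpoch A' (int n)))) in
        (summable f \<longrightarrow>
          G3 A A' (x / (1 - t)^2) (y * (1 - t)) ** one_minus_pow_neg t A' = (\<Sum>n. f n)) \<and>
        ((\<forall>s. norm s \<le> norm t \<longrightarrow> (x / (1 - s)^2, y * (1 - s)) \<in> G3_domain A A') \<longrightarrow>
          summable f)))"
proof (intro conjI impI)
  let ?f = "\<lambda>n::nat. t ^ n *\<^sub>M
      (((1 / fact n) *\<^sub>M mpoch A (int n)) ** G3 (A + mat (of_nat n)) A' x y)"
  assume "(\<forall>n::nat. mpoch_defined (A + mat (of_nat n))) \<and> mpoch_defined A' \<and>
      (x, y) \<in> G3_domain A A' \<and> (x * (1 - t), y / (1 - t)^2) \<in> G3_domain A A'"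
  then have hyps: "\<And>n::nat. mpoch_defined (A + mat (of_nat n))" "(x, y) \<in> G3_domain A A'"
      "(x * (1 - t), y / (1 - t)^2) \<in> G3_domain A A'"
    by auto
  show "let f = ?f in
        (summable f \<longrightarrow>
          one_minus_pow_neg t A ** G3 A A' (x * (1 - t)) (y / (1 - t)^2) = (\<Sum>n. f n)) \<and>
        ((\<forall>s. norm s \<le> norm t \<longrightarrow> (x * (1 - s), y / (1 - s)^2) \<in> G3_domain A A') \<longrightarrow>
          summable f)"
    unfolding Let_def mpoch_of_nat
    using G3_left_summation[OF assms hyps] by (blast intro: sums_unique)
next
  let ?f = "\<lambda>n::nat. t ^ n *\<^sub>M
      (G3 A (A' + mat (of_nat n)) x y ** ((1 / fact n) *\<^sub>M mpoch A' (int n)))"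
  let ?B = "transpose A'" and ?B' = "transpose A"
  let ?g = "\<lambda>n::nat. t ^ n *\<^sub>M
      (((1 / fact n) *\<^sub>M mpoch_nat ?B n) ** G3 (?B + mat (of_nat n)) ?B' y x)"
  let ?lhs = "G3 A A' (x / (1 - t)^2) (y * (1 - t)) ** one_minus_pow_neg t A'"
  assume "mpoch_defined A \<and> (\<forall>n::nat. mpoch_defined (A' + mat (of_nat n))) \<and>
      (x, y) \<in> G3_domain A A' \<and> (x / (1 - t)^2, y * (1 - t)) \<in> G3_domain A A'"
  then have defA: "mpoch_defined A" and defA': "\<And>n::nat. mpoch_defined (A' + mat (of_nat n))"
    and dom: "(x, y) \<in> G3_domain A A'" "(x / (1 - t)^2, y * (1 - t)) \<in> G3_domain A A'"
    by auto
  have A': "mpoch_defined A'"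
    using defA'[of 0] by simp
  have B: "mpoch_defined (?B + mat (of_nat n))" for n :: nat
    using mpoch_defined_transpose[OF defA'[of n]] by (simp add: transpose_add)
  note domT = G3_domain_transpose[OF defA A']
  have fg: "transpose (?f n) = ?g n" for n
    using transpose_G3[OF defA defA'[of n]]
    by (simp add: transpose_mscale matrix_transpose_mul transpose_mpoch_nat transpose_add)
  have gf: "transpose (?g n) = ?f n" for n
    by (simp only: fg[symmetric] transpose_transpose)
  note left = G3_left_summation[OF assms B domT[OF dom(1)] domT[OF dom(2)]]
  have "?lhs = suminf ?f" if "summable ?f"
  proof -
    have "summable ?g"
      using bounded_linear.summable[OF bounded_linear_transpose that] unfolding fg .
    then have "?g sums transpose ?lhs"
      using left(1) by (simp only: matrix_transpose_mul transpose_G3[OF defA A']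
          transpose_one_minus_pow_neg[OF assms])
    then have "(\<lambda>n. transpose (?g n)) sums transpose (transpose ?lhs)"
      by (rule bounded_linear.sums[OF bounded_linear_transpose])
    then show ?thesis
      unfolding gf transpose_transpose by (rule sums_unique)
  qed
  moreover have "summable ?f"
    if "\<forall>s. norm s \<le> norm t \<longrightarrow> (x / (1 - s)^2, y * (1 - s)) \<in> G3_domain A A'"
  proof -
    have "summable ?g"
      by (rule left(2)) (use that domT in blast)
    then have "summable (\<lambda>n. transpose (?g n))"
      by (rule bounded_linear.summable[OF bounded_linear_transpose])
    then show ?thesis
      unfolding gf .
  qed
  ultimately show "let f = ?f in
        (summable f \<longrightarrow> ?lhs = (\<Sum>n. f n)) \<and>
        ((\<forall>s. norm s \<le> norm t \<longrightarrow> (x / (1 - s)^2, y * (1 - s)) \<in> G3_domain A A') \<longrightarrow>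
          summable f)"
    unfolding Let_def by blast
qed

end
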